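(* Let $n\ge2$. The $\mathbb Q$-span $\mathfrak A_{\vartriangle,\mathbb Q}[n]$ of the elements $A[\mathbf j]$ ($A\in\Theta^\pm_\vartriangle(n)$, $\mathbf j\in\mathbb N^n_\vartriangle$) is a subalgebra of $\prod_{r\ge0}\mathcal S_\vartriangle(n,r)_{\mathbb Q}$, with $\mathbb Q$-basis $\{A[\mathbf j]\mid A\in\Theta^\pm_\vartriangle(n),\ \mathbf j\in\mathbb N^n_\vartriangle\}$. Moreover the map $\eta=\prod_{r\ge0}\eta_r:\mathcal U(\widehat{\mathfrak{gl}}_n)\to\prod_{r\ge0}\mathcal S_\vartriangle(n,r)_{\mathbb Q}$ is injective and induces a $\mathbb Q$-algebra isomorphism $\mathcal U(\widehat{\mathfrak{gl}}_n)\cong\mathfrak A_{\vartriangle,\mathbb Q}[n]$.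
   Context: The loop algebra $\widehat{\mathfrak{gl}}_n=\mathfrak{gl}_n(\mathbb Q)\otimes\mathbb Q[t,t^{-1}]$ is identified with the Lie algebra (commutator bracket) of $\mathbb Z\times\mathbb Z$ rational matrices $(a_{i,j})$ with $a_{i+n,j+n}=a_{i,j}$ and finitely many nonzero entries in each row; it has basis $E^\vartriangle_{i,j}$ ($1\le i\le n$, $j\in\mathbb Z$), where $E^\vartriangle_{i,j}$ has $1$ at positions $(i+sn,j+sn)$, $s\in\mathbb Z$, and $0$ elsewhere. $\mathcal U(\widehat{\mathfrak{gl}}_n)$ is its universal enveloping algebra. It acts on $\Omega_{\mathbb Q}$ (basis $\omega_k$, $k\in\mathbb Z$) by $E^\vartriangle_{i,j}\omega_k=\omega_{i+tn}$ if $k=j+tn$ ($t\in\mathbb Z$) and $0$ otherwise, and on $\Omega_{\mathbb Q}^{\otimes r}$ by $x(w_1\otimes\cdots\otimes w_r)=\sum_s w_1\otimes\cdots\otimes xw_s\otimes\cdots\otimes w_r$. $I_\vartriangle(n,r)$ is the set of integer sequences $\mathbf i=(i_k)_{k\in\mathbb Z}$ with $i_{k+r}=i_k+n$; $\omega_{\mathbf i}:=\omega_{i_1}\otimes\cdots\otimes\omega_{i_r}$. The affine symmetric group $\mathfrak S_{\vartriangle,r}$ (bijections $w:\mathbb Z\to\mathbb Z$, $w(k+r)=w(k)+r$) acts on the right by $\omega_{\mathbf i}w=\omega_{\mathbf iw}$, $(\mathbf iw)_k=i_{w(k)}$; this commutes with the $\mathcal U(\widehat{\mathfrak{gl}}_n)$-action,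 giving algebra homomorphisms $\eta_r:\mathcal U(\widehat{\mathfrak{gl}}_n)\to\mathcal S_\vartriangle(n,r)_{\mathbb Q}:=\mathrm{End}_{\mathbb Q\mathfrak S_{\vartriangle,r}}(\Omega_{\mathbb Q}^{\otimes r})$ (composition as product; $\mathcal S_\vartriangle(n,0)_{\mathbb Q}=\mathbb Q$). $\Theta_\vartriangle(n)$ is the set of matrices over $\mathbb N$ with $a_{k+n,l+n}=a_{k,l}$ and finitely many nonzero entries per row; $\sigma(A)=\sum_{1\le k\le n,\,l}a_{k,l}$; $\Theta_\vartriangle(n,r)=\{A\mid\sigma(A)=r\}$; $\Theta^\pm_\vartriangle(n)$ consists of those $A$ with zero diagonal. For $\mathbf i,\mathbf j\in I_\vartriangle(n,r)$, $M(\mathbf i,\mathbf j)=(a_{k,l})$ with $a_{k,l}=|\{s\in\mathbb Z\mid i_s=k,\ j_s=l\}|$; for $A\in\Theta_\vartriangle(n,r)$, $[A]_1$ is the endomorphism $\omega_{\mathbf j}\mapsto\sum_{\mathbf i:M(\mathbf i,\mathbf j)=A}\omega_{\mathbf i}$. $\mathbb N^n_\vartriangle$ is the set of $n$-periodic sequences of nonnegative integers, $\Lambda_\vartriangle(n,m)=\{\lambda\in\mathbb N^n_\vartriangle\mid\sum_{i=1}^n\lambda_i=m\}$, $\mathrm{diag}(\lambda)$ the diagonal matrix with entries $\lambda_i$, $\lambda^{\mathbf j}=\prod_{i=1}^n\lambda_i^{j_i}$ ($0^0=1$). For $A\in\Theta^\pm_\vartriangle(n)$: $A[\mathbf j,r]=\sum_{\lambda\in\Lambda_\vartriangle(n,r-\sigma(A))}\lambda^{\mathbf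 j}[A+\mathrm{diag}(\lambda)]_1$ if $\sigma(A)\le r$ and $0$ otherwise, and $A[\mathbf j]=(A[\mathbf j,r])_{r\ge0}\in\prod_{r\ge0}\mathcal S_\vartriangle(n,r)_{\mathbb Q}$ (componentwise product). *)

theory Defs
  imports Complex_Main
begin

text \<open>A basis vector omega_{i_1} (x) ... (x) omega_{i_r} of Omega^{tensor r} is the list
  [i_1,...,i_r] :: int list.  An element of prod_{r>=0} End(Omega^{tensor r}) is encoded as one
  block-diagonal matrix X :: int list => int list => rat, where X v w is the coefficient of
  omega_v in X(omega_w); entries between lists of different lengths vanish, and each column is
  finitely supported.  The componentwise product then is matrix composition.\<close>

type_synonym mat = "int list \<Rightarrow> int list \<Rightarrow> rat"

definition blockmat :: "mat \<Rightarrow> bool" where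
  "blockmat X \<longleftrightarrow> (\<forall>v w. length v \<noteq> length w \<longrightarrow> X v w = 0)
                   \<and> (\<forall>w. finite {v. X v w \<noteq> 0})"

definition mprod :: "mat \<Rightarrow> mat \<Rightarrow> mat" where
  "mprod X Y = (\<lambda>v w. \<Sum>u\<in>{u. Y u w \<noteq> 0}. X v u * Y u w)"

definition idm :: mat where
  "idm = (\<lambda>v w. if v = w then 1 else 0)"

text \<open>The periodic extension i in I_Delta(n,r) of a list [i_1..i_r]: i_{k+r} = i_k + n.\<close>
definition ext :: "nat \<Rightarrow> int list \<Rightarrow> int \<Rightarrow> int" where
  "ext n l s = l ! nat ((s - 1) mod int (length l)) + int n * ((s - 1) div int (length l))"

definition AffSym :: "nat \<Rightarrow> (int \<Rightarrow> int) set" where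
  "AffSym r = {w. bij w \<and> (\<forall>k. w (k + int r) = w k + int r)}"

definition act :: "nat \<Rightarrow> int list \<Rightarrow> (int \<Rightarrow> int) \<Rightarrow> int list" where
  "act n l w = map (\<lambda>k. ext n l (w (int k))) [1..<Suc (length l)]"

text \<open>prod_{r>=0} S_Delta(n,r)_Q: block matrices commuting with the affine symmetric groups
  (X(omega_u w) = (X omega_u) w, i.e. X (v w) (u w) = X v u, as w permutes the basis).\<close>
definition SchurProd :: "nat \<Rightarrow> mat set" where
  "SchurProd n = {X. blockmat X \<and>
     (\<forall>v u w. length v = length u \<longrightarrow> w \<in> AffSym (length u) \<longrightarrow>
        X (act n v w) (act n u w) = X v u)}"

type_synonym zmat = "int \<Rightarrow> int \<Rightarrow> nat"

definition Theta :: "nat \<Rightarrow> zmat set" where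
  "Theta n = {A. (\<forall>k l. A (k + int n) (l + int n) = A k l) \<and> (\<forall>k. finite {l. A k l \<noteq> 0})}"

definition ThetaPM :: "nat \<Rightarrow> zmat set" where
  "ThetaPM n = {A \<in> Theta n. \<forall>k. A k k = 0}"

definition sigma :: "nat \<Rightarrow> zmat \<Rightarrow> nat" where
  "sigma n A = (\<Sum>k\<in>{1..int n}. \<Sum>l\<in>{l. A k l \<noteq> 0}. A k l)"

definition NDelta :: "nat \<Rightarrow> (int \<Rightarrow> nat) set" where
  "NDelta n = {j. \<forall>i. j (i + int n) = j i}"

definition LambdaD :: "nat \<Rightarrow> nat \<Rightarrow> (int \<Rightarrow> nat) set" where
  "LambdaD n m = {la \<in> NDelta n. (\<Sum>i\<in>{1..int n}. la i) = m}"

definition diagm :: "(int \<Rightarrow> nat) \<Rightarrow> zmat" where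
  "diagm la = (\<lambda>k l. if k = l then la k else 0)"

definition mpow :: "nat \<Rightarrow> (int \<Rightarrow> nat) \<Rightarrow> (int \<Rightarrow> nat) \<Rightarrow> nat" where
  "mpow n la j = (\<Prod>i\<in>{1..int n}. la i ^ j i)"

definition Mm :: "nat \<Rightarrow> int list \<Rightarrow> int list \<Rightarrow> zmat" where
  "Mm n v w = (\<lambda>k l. if v = [] then 0 else card {s::int. ext n v s = k \<and> ext n w s = l})"

definition B1 :: "nat \<Rightarrow> zmat \<Rightarrow> mat" where
  "B1 n A = (\<lambda>v w. if length v = sigma n A \<and> length w = sigma n A \<and> Mm n v w = A then 1 else 0)"

definition Aj :: "nat \<Rightarrow> zmat \<Rightarrow> (int \<Rightarrow> nat) \<Rightarrow> mat" where
  "Aj n A j = (\<lambda>v w. if length v = length w \<and> sigma n A \<le> length w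
      then (\<Sum>la\<in>LambdaD n (length w - sigma n A).
              of_nat (mpow n la j) * B1 n (\<lambda>k l. A k l + diagm la k l) v w)
      else 0)"

definition AIdx :: "nat \<Rightarrow> (zmat \<times> (int \<Rightarrow> nat)) set" where
  "AIdx n = ThetaPM n \<times> NDelta n"

definition Aspan :: "nat \<Rightarrow> mat set" where
  "Aspan n = {X. \<exists>F c. finite F \<and> F \<subseteq> AIdx n \<and>
      X = (\<lambda>v w. \<Sum>p\<in>F. c p * Aj n (fst p) (snd p) v w)}"

text \<open>Basis E_{i,j} of the loop algebra is indexed by letters (i,j), 1 <= i <= n, j in Z;
  as a periodic Z x Z matrix E_{i,j} has 1 exactly at the positions (i+tn, j+tn).\<close>
definition Letters :: "nat \<Rightarrow> (int \<times> int) set" where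
  "Letters n = {(i, j). 1 \<le> i \<and> i \<le> int n}"

definition Emat :: "nat \<Rightarrow> int \<times> int \<Rightarrow> int \<Rightarrow> int \<Rightarrow> rat" where
  "Emat n x = (\<lambda>a b. if (\<exists>t::int. a = fst x + t * int n \<and> b = snd x + t * int n) then 1 else 0)"

definition zmul :: "(int \<Rightarrow> int \<Rightarrow> rat) \<Rightarrow> (int \<Rightarrow> int \<Rightarrow> rat) \<Rightarrow> int \<Rightarrow> int \<Rightarrow> rat" where
  "zmul X Y = (\<lambda>a b. \<Sum>c\<in>{c. X a c \<noteq> 0}. X a c * Y c b)"

text \<open>Coefficient of E_z (z a letter) in the commutator [E_x, E_y].\<close>
definition br :: "nat \<Rightarrow> int \<times> int \<Rightarrow> int \<times> int \<Rightarrow> int \<times> int \<Rightarrow> rat" where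
  "br n x y z = zmul (Emat n x) (Emat n y) (fst z) (snd z)
              - zmul (Emat n y) (Emat n x) (fst z) (snd z)"

text \<open>Tensor algebra T(gl_n^) over Q: finitely supported Q-combinations of words in the basis
  letters; multiplication is concatenation of words.\<close>
definition Tfin :: "nat \<Rightarrow> ((int \<times> int) list \<Rightarrow> rat) set" where
  "Tfin n = {f. finite {w. f w \<noteq> 0} \<and> (\<forall>w. f w \<noteq> 0 \<longrightarrow> set w \<subseteq> Letters n)}"

text \<open>The element u (x y - y x - [x,y]) v of T for words u, v and letters x, y.\<close>
definition relgen :: "nat \<Rightarrow> (int \<times> int) list \<times> (int \<times> int) \<times> (int \<times> int) \<times> (int \<times> int) list
                        \<Rightarrow> (int \<times> int) list \<Rightarrow> rat" where
  "relgen n q w = (case q of (u, x, y, v) \<Rightarrow>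
      (if w = u @ [x, y] @ v then 1 else 0) - (if w = u @ [y, x] @ v then 1 else 0)
      - (if length w = length u + 1 + length v \<and> take (length u) w = u
            \<and> drop (length u + 1) w = v \<and> w ! length u \<in> Letters n
         then br n x y (w ! length u) else 0))"

text \<open>The two-sided ideal of T defining U(gl_n^) = T / Irel.\<close>
definition Irel :: "nat \<Rightarrow> ((int \<times> int) list \<Rightarrow> rat) set" where
  "Irel n = {f. \<exists>F c. finite F \<and>
      F \<subseteq> {(u, x, y, v). set u \<subseteq> Letters n \<and> x \<in> Letters n \<and> y \<in> Letters n \<and> set v \<subseteq> Letters n} \<and>
      f = (\<lambda>w. \<Sum>q\<in>F. c q * relgen n q w)}"

text \<open>Action of E_{i,j} on Omega^{tensor r}: E_{i,j} omega_k = omega_{i+tn} if k = j+tn,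
  extended as a derivation to tensor powers; matrix entry = number of positions s
  producing the basis vector v from w.\<close>
definition etaE :: "nat \<Rightarrow> int \<times> int \<Rightarrow> mat" where
  "etaE n x = (\<lambda>v w. of_nat (card {s. s < length w \<and> (w ! s - snd x) mod int n = 0
                         \<and> v = w[s := fst x + (w ! s - snd x)]}))"

definition eta_word :: "nat \<Rightarrow> (int \<times> int) list \<Rightarrow> mat" where
  "eta_word n ws = foldr (\<lambda>x M. mprod (etaE n x) M) ws idm"

text \<open>eta = prod_r eta_r, lifted to T (an algebra homomorphism T -> prod_r End).\<close>
definition eta :: "nat \<Rightarrow> ((int \<times> int) list \<Rightarrow> rat) \<Rightarrow> mat" where
  "eta n f = (\<lambda>v u. \<Sum>w\<in>{w. f w \<noteq> 0}. f w * eta_word n w v u)"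

end

theory Submission
  imports Defs "HOL-Library.Multiset" "HOL-Library.FuncSet" "HOL-Library.Function_Algebras"
    "HOL-Computational_Algebra.Polynomial"
begin

text \<open>
  An endomorphism [A] only sees the matrix M(v,w), which amounts to the multiset of the pairs
  (v_s, w_s) modulo simultaneous translation by n, that is, to a multiset of letters. As a
  function of this multiset, A[j] is the indicator of the off-diagonal part A times the monomial
  with exponents j in the multiplicities of the diagonal letters. So the elements A[j] are indexed
  by multisets K of letters, and they are independent because monomials are.

  Left multiplication by the image of the letter x sends the element of index K to a nonzero
  multiple of the element of index K + x, up to elements of index of size at most that of K. Hence
  the image of a word with multiset K has a nonzero leading term at K, which gives the image of
  eta. For the kernel, words that are permutations of each other agree modulo the defining
  relations and shorter words. An element of the kernel can therefore be reduced to one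
  representative word for each multiset of top size, where the leading terms force all coefficients
  to vanish; induction on the length finishes the argument.
\<close>

text \<open>Off-diagonal matrices leave the diagonal free, so the exponents j are stored there. One
  index type, multisets of letters, then serves for matrices M(v,w), for the elements A[j] and for
  words up to permutation. The degree sigma(A) + |j| of A[j] is the size of its index and
  corresponds to the length of a word; only degrees are compared, never letters. The leading term
  arises as follows. On functions of M(v,w), E_{i,k} exchanges a pair (i,b) for (k,b). If b = k and
  i differs from k, a diagonal multiplicity X becomes X+1, and (X+1)^j has top term X^j; the factor
  counting the exchanged pair is one more than its multiplicity in A, which is nonzero in
  characteristic 0. If b = i, the factor X(X-1)^j gains a degree, but A loses a letter, so the total
  degree does not grow. Closure under products comes last, as a consequence of the image: an element
  of the span is a combination of images of words, and the letters map the span into itself.\<close>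

lemma sum_fun_apply: "(\<Sum>i\<in>I. f i) x = (\<Sum>i\<in>I. f i x)"
  for f :: "'i \<Rightarrow> 'a \<Rightarrow> 'b::comm_monoid_add"
  by (induction I rule: infinite_finite_induct) auto

text \<open>Bridges spans as sums over vectors and the sums over indices by which
  \<open>Aspan\<close> and \<open>Irel\<close> are defined. Different indices may give the same
  vector, hence the choice of a set of preimages on which \<open>g\<close> is injective.\<close>

lemma (in module) span_image_explicit:
  "span (g ` I) = {\<Sum>p\<in>F. c p *s g p | F c. finite F \<and> F \<subseteq> I}"
proof (intro equalityI subsetI)
  fix x assume "x \<in> span (g ` I)"
  then obtain t r where t: "finite t" "t \<subseteq> g ` I" "x = (\<Sum>a\<in>t. r a *s a)"
    unfolding span_explicit by auto
  from t(2) obtain U where U: "U \<subseteq> I" "inj_on g U" "t = g ` U"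
    by (auto simp: subset_image_inj)
  have "x = (\<Sum>p\<in>U. r (g p) *s g p)"
    using U t(3) by (simp add: sum.reindex)
  moreover have "finite U" using U t(1) by (simp add: finite_image_iff)
  ultimately show "x \<in> {\<Sum>p\<in>F. c p *s g p | F c. finite F \<and> F \<subseteq> I}"
    using U(1) by (intro CollectI exI[of _ U] exI[of _ "\<lambda>p. r (g p)"]) auto
next
  fix x assume "x \<in> {\<Sum>p\<in>F. c p *s g p | F c. finite F \<and> F \<subseteq> I}"
  then obtain F c where "F \<subseteq> I" "x = (\<Sum>p\<in>F. c p *s g p)" by blast
  then show "x \<in> span (g ` I)"
    by (auto intro!: span_sum span_scale intro: span_base)
qed

interpretation fsp: vector_space "\<lambda>(c::rat) (f::'a \<Rightarrow> rat) w. c * f w"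
  by unfold_locales (simp_all add: fun_eq_iff distrib_left distrib_right)

interpretation msp: vector_space "\<lambda>(c::rat) (X::mat) v w. c * X v w"
  by unfold_locales (simp_all add: fun_eq_iff distrib_left distrib_right)

text \<open>The representative, with first coordinate in 1..n, of the class of a pair under
  simultaneous translation by n. The shift by 1 before dividing gives residues 1..n instead of
  0..n-1.\<close>

definition letter_of :: "nat \<Rightarrow> int \<times> int \<Rightarrow> int \<times> int" where
  "letter_of n p = ((fst p - 1) mod int n + 1, snd p - int n * ((fst p - 1) div int n))"

definition offd :: "(int \<times> int) multiset \<Rightarrow> (int \<times> int) multiset" where
  "offd N = filter_mset (\<lambda>y. fst y \<noteq> snd y) N"

text \<open>The matrix M(i,j) in Theta, recorded as the multiset of the pairs (v_s, w_s)
  modulo simultaneous translation by n.\<close>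
definition pairs :: "nat \<Rightarrow> int list \<Rightarrow> int list \<Rightarrow> (int \<times> int) multiset" where
  "pairs n v w = image_mset (letter_of n) (mset (zip v w))"

definition mon :: "nat \<Rightarrow> (int \<times> int) multiset \<Rightarrow> (int \<Rightarrow> nat) \<Rightarrow> (int \<times> int) multiset \<Rightarrow> rat" where
  "mon n A j N = (if offd N = A then (\<Prod>i\<in>{1..int n}. of_nat (count N (i, i)) ^ j i) else 0)"

text \<open>The length test is essential: \<open>zip\<close> truncates, so \<open>pairs\<close> also
  returns a multiset for lists of different lengths.\<close>

definition lift :: "nat \<Rightarrow> ((int \<times> int) multiset \<Rightarrow> rat) \<Rightarrow> mat" where
  "lift n f = (\<lambda>v w. if length v = length w then f (pairs n v w) else 0)"

text \<open>The element A[j], indexed by the multiset of letters with off-diagonal part A and with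
  j i copies of (i,i).\<close>
definition bm :: "nat \<Rightarrow> (int \<times> int) multiset \<Rightarrow> mat" where
  "bm n K = lift n (mon n (offd K) (\<lambda>i. count K (i, i)))"

definition LMsets :: "nat \<Rightarrow> (int \<times> int) multiset set" where
  "LMsets n = {K. set_mset K \<subseteq> Letters n}"

lemma letter_of_in_Letters: "n > 0 \<Longrightarrow> letter_of n p \<in> Letters n"
  using pos_mod_bound[of "int n" "fst p - 1"] pos_mod_sign[of "int n" "fst p - 1"]
  unfolding letter_of_def Letters_def by (auto simp del: pos_mod_bound)

lemma letter_of_Letters: "x \<in> Letters n \<Longrightarrow> letter_of n x = x"
  by (auto simp: letter_of_def Letters_def prod_eq_iff)

text \<open>A class modulo simultaneous translation is determined by the residue of the first
  coordinate and by the difference of the coordinates.\<close>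

lemma letter_of_eq_iff:
  assumes "n > 0"
  shows "letter_of n (a, b) = letter_of n (k, l) \<longleftrightarrow> int n dvd a - k \<and> a - b = k - l"
proof
  assume *: "letter_of n (a, b) = letter_of n (k, l)"
  then have 1: "(a - 1) mod int n = (k - 1) mod int n"
    and 2: "b - int n * ((a - 1) div int n) = l - int n * ((k - 1) div int n)"
    by (auto simp: letter_of_def)
  from 1 have "int n dvd (a - 1) - (k - 1)" by (simp only: mod_eq_dvd_iff)
  moreover have "a - b = k - l"
    using 1 2 mult_div_mod_eq[of "int n" "a - 1"] mult_div_mod_eq[of "int n" "k - 1"] by linarith
  ultimately show "int n dvd a - k \<and> a - b = k - l" by simp
next
  assume *: "int n dvd a - k \<and> a - b = k - l"
  then obtain t where "a - k = int n * t" by (auto elim: dvdE)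
  then have t: "a = k + int n * t" by simp
  have "a - 1 = (k - 1) + int n * t" using t by simp
  then have "(a - 1) mod int n = (k - 1) mod int n" "(a - 1) div int n = (k - 1) div int n + t"
    using assms by (simp_all only: mod_mult_self2 div_mult_self2)
  moreover have "b = l + int n * t" using * t by linarith
  ultimately show "letter_of n (a, b) = letter_of n (k, l)"
    by (simp add: letter_of_def distrib_left)
qed

lemma letter_of_diff: "fst (letter_of n p) - snd (letter_of n p) = fst p - snd p"
  using mult_div_mod_eq[of "int n" "fst p - 1"] by (simp add: letter_of_def algebra_simps)

lemma fst_eq_snd_letter_of [simp]: "fst (letter_of n p) = snd (letter_of n p) \<longleftrightarrow> fst p = snd p"
  using letter_of_diff[of n p] by auto

lemma pairs_in_LMsets: "n > 0 \<Longrightarrow> pairs n v w \<in> LMsets n"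
  unfolding pairs_def LMsets_def using letter_of_in_Letters by auto

lemma size_pairs: "length v = length w \<Longrightarrow> size (pairs n v w) = length w"
  by (simp add: pairs_def)

text \<open>Identities between lifted functions can therefore be tested on arbitrary multisets of
  letters: enumerate the multiset and unzip it.\<close>

lemma pairs_surj:
  assumes "N \<in> LMsets n"
  obtains v w where "length v = length w" "pairs n v w = N"
proof -
  obtain xs where xs: "mset xs = N" using ex_mset by blast
  have "image_mset (letter_of n) N = image_mset id N"
    using assms letter_of_Letters by (intro image_mset_cong) (auto simp: LMsets_def)
  then have "pairs n (map fst xs) (map snd xs) = N"
    using xs by (simp add: pairs_def zip_map_fst_snd)
  then show ?thesis using that[of "map fst xs" "map snd xs"] by simp
qed

section \<open>Matrices as multisets of letters\<close>

lemma periodic_int: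
  fixes f :: "int \<Rightarrow> 'a"
  assumes "\<And>i. f (i + int n) = f i"
  shows "f (i + int n * t) = f i"
proof (induction t rule: int_induct[of _ 0])
  case (step1 t)
  then show ?case using assms[of "i + int n * t"] by (simp add: algebra_simps)
next
  case (step2 t)
  then show ?case using assms[of "i + int n * (t - 1)"] by (simp add: algebra_simps)
qed simp

lemma count_pairs:
  assumes "length v = length w"
  shows "count (pairs n v w) y = card {s. s < length v \<and> letter_of n (v ! s, w ! s) = y}"
proof -
  have "pairs n v w = mset (map (letter_of n) (zip v w))" by (simp add: pairs_def)
  also have "count \<dots> y = card {m. m < length v \<and> y = map (letter_of n) (zip v w) ! m}"
    unfolding count_mset count_list_eq_length_filter length_filter_conv_card using assms by simp
  also have "{m. m < length v \<and> y = map (letter_of n) (zip v w) ! m}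
      = {s. s < length v \<and> letter_of n (v ! s, w ! s) = y}"
    using assms by auto
  finally show ?thesis .
qed

text \<open>The integers s fall into r residue classes, one for each position m of the lists. Along
  such a class the pair of extended values runs once through the translates of (v_m, w_m), so the
  class contributes one s if (v_m, w_m) is equivalent to (k,l), and none otherwise.\<close>

lemma Mm_eq_count:
  assumes n: "n > 0" and len: "length v = length w"
  shows "Mm n v w k l = count (pairs n v w) (letter_of n (k, l))"
proof (cases "v = []")
  case True
  then show ?thesis by (simp add: Mm_def pairs_def)
next
  case False
  define r where "r = length v"
  have r: "r > 0" using False by (simp add: r_def)
  define P where "P = {m. m < r \<and> letter_of n (v ! m, w ! m) = letter_of n (k, l)}"
  \<comment> \<open>The only candidate s in the class of position m: s = m + 1 + r t, where t solves
    v_m + n t = k. The 1 appears because positions count from 0 and sequences from 1.\<close>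
  define g where "g m = 1 + int m + int r * ((k - v ! m) div int n)" for m
  have ext_v: "ext n v s = v ! nat ((s - 1) mod int r) + int n * ((s - 1) div int r)" for s
    by (simp add: ext_def r_def)
  have ext_w: "ext n w s = w ! nat ((s - 1) mod int r) + int n * ((s - 1) div int r)" for s
    by (simp add: ext_def r_def len)
  have gmod: "(g m - 1) mod int r = int m" "(g m - 1) div int r = (k - v ! m) div int n"
    if "m < r" for m
    using that r by (simp_all add: g_def)
  have P_iff: "m \<in> P \<longleftrightarrow> m < r \<and> int n dvd k - v ! m \<and> w ! m - v ! m = l - k" for m
    using letter_of_eq_iff[OF n, of "v ! m" "w ! m" k l]
    by (auto simp: P_def dvd_diff_commute)
  have "bij_betw g P {s. ext n v s = k \<and> ext n w s = l}"
  proof (rule bij_betwI[where g = "\<lambda>s. nat ((s - 1) mod int r)"])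
    show "g \<in> P \<rightarrow> {s. ext n v s = k \<and> ext n w s = l}"
    proof
      fix m assume "m \<in> P"
      then have m: "m < r" "int n dvd k - v ! m" "w ! m - v ! m = l - k" by (auto simp: P_iff)
      have "int n * ((k - v ! m) div int n) = k - v ! m" using m(2) by simp
      then show "g m \<in> {s. ext n v s = k \<and> ext n w s = l}"
        using m by (simp add: ext_v ext_w gmod)
    qed
    show "(\<lambda>s. nat ((s - 1) mod int r)) \<in> {s. ext n v s = k \<and> ext n w s = l} \<rightarrow> P"
    proof
      fix s assume s: "s \<in> {s. ext n v s = k \<and> ext n w s = l}"
      have "nat ((s - 1) mod int r) < r"
        using pos_mod_bound[of "int r" "s - 1"] r by (simp add: nat_less_iff)
      then show "nat ((s - 1) mod int r) \<in> P"
        using s by (auto simp: P_iff ext_v ext_w)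
    qed
    show "nat ((g m - 1) mod int r) = m" if "m \<in> P" for m
      using that gmod(1)[of m] by (simp add: P_iff)
    show "g (nat ((s - 1) mod int r)) = s" if "s \<in> {s. ext n v s = k \<and> ext n w s = l}" for s
    proof -
      have "k - v ! nat ((s - 1) mod int r) = int n * ((s - 1) div int r)"
        using that by (simp add: ext_v)
      then have "(k - v ! nat ((s - 1) mod int r)) div int n = (s - 1) div int r"
        using n by simp
      then show ?thesis using r mod_mult_div_eq[of "s - 1" "int r"] by (simp add: g_def)
    qed
  qed
  then have "card {s. ext n v s = k \<and> ext n w s = l} = card P"
    by (simp add: bij_betw_same_card)
  moreover have "count (pairs n v w) (letter_of n (k, l)) = card P"
    using count_pairs[OF len, of n "letter_of n (k, l)"] by (simp add: P_def r_def)
  ultimately show ?thesis using False by (simp add: Mm_def)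
qed

definition Theta_mset :: "nat \<Rightarrow> zmat \<Rightarrow> (int \<times> int) multiset" where
  "Theta_mset n B = Abs_multiset (\<lambda>x. if x \<in> Letters n then B (fst x) (snd x) else 0)"

lemma Theta_supp:
  "{x. (if x \<in> Letters n then B (fst x) (snd x) else 0) \<noteq> 0}
    = Sigma {1..int n} (\<lambda>k. {l. B k l \<noteq> 0})"
  by (auto simp: Letters_def)

lemma Theta_supp_finite:
  assumes "B \<in> Theta n"
  shows "finite (Sigma {1..int n} (\<lambda>k. {l. B k l \<noteq> 0}))"
  using assms by (auto simp: Theta_def)

lemma count_Theta_mset:
  assumes "B \<in> Theta n"
  shows "count (Theta_mset n B) x = (if x \<in> Letters n then B (fst x) (snd x) else 0)"
proof -
  have "finite {x. 0 < (if x \<in> Letters n then B (fst x) (snd x) else 0)}"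
    using Theta_supp[of n B] Theta_supp_finite[OF assms] by simp
  then show ?thesis unfolding Theta_mset_def by (subst count_Abs_multiset) auto
qed

lemma Theta_mset_in_LMsets: "B \<in> Theta n \<Longrightarrow> Theta_mset n B \<in> LMsets n"
  by (auto simp: LMsets_def count_Theta_mset simp flip: count_greater_zero_iff split: if_splits)

lemma size_Theta_mset:
  assumes "B \<in> Theta n"
  shows "size (Theta_mset n B) = sigma n B"
proof -
  have "set_mset (Theta_mset n B) = Sigma {1..int n} (\<lambda>k. {l. B k l \<noteq> 0})"
    unfolding Theta_supp[symmetric] set_mset_def count_Theta_mset[OF assms] by auto
  then have "size (Theta_mset n B)
      = (\<Sum>x\<in>Sigma {1..int n} (\<lambda>k. {l. B k l \<noteq> 0}). count (Theta_mset n B) x)"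
    by (simp add: size_multiset_overloaded_eq)
  also have "\<dots> = (\<Sum>(k, l)\<in>Sigma {1..int n} (\<lambda>k. {l. B k l \<noteq> 0}). B k l)"
    by (intro sum.cong) (auto simp: count_Theta_mset[OF assms] Letters_def)
  also have "\<dots> = sigma n B"
    using assms unfolding sigma_def by (subst sum.Sigma) (auto simp: Theta_def)
  finally show ?thesis .
qed

lemma Theta_letter:
  assumes "B \<in> Theta n" "n > 0"
  shows "B k l = B (fst (letter_of n (k, l))) (snd (letter_of n (k, l)))"
proof -
  define t where "t = (k - 1) div int n"
  have "B (k + (s + int n)) (l + (s + int n)) = B (k + s) (l + s)" for s
    using assms(1) by (simp add: Theta_def add.assoc[symmetric])
  from periodic_int[of "\<lambda>s. B (k + s) (l + s)", OF this, of 0 "- t"]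
  have "B (k - int n * t) (l - int n * t) = B k l" by simp
  moreover have "k - int n * t = fst (letter_of n (k, l))"
    using mult_div_mod_eq[of "int n" "k - 1"] unfolding letter_of_def t_def fst_conv by linarith
  ultimately show ?thesis by (simp add: letter_of_def t_def)
qed

lemma count_Theta_mset_letter:
  assumes "B \<in> Theta n" "n > 0"
  shows "count (Theta_mset n B) (letter_of n (k, l)) = B k l"
  using Theta_letter[OF assms, of k l] letter_of_in_Letters[OF assms(2)]
  by (simp add: count_Theta_mset[OF assms(1)])

lemma Mm_in_Theta:
  assumes n: "n > 0" and len: "length v = length w"
  shows "Mm n v w \<in> Theta n"
proof -
  have "letter_of n (k + int n, l + int n) = letter_of n (k, l)" for k l
    by (subst letter_of_eq_iff[OF n]) auto
  moreover have "finite {l. count K (letter_of n (k, l)) \<noteq> 0}" for k K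
  proof (rule finite_imageD)
    show "finite ((\<lambda>l. letter_of n (k, l)) ` {l. count K (letter_of n (k, l)) \<noteq> 0})"
      by (rule finite_subset[of _ "set_mset K"]) auto
    show "inj_on (\<lambda>l. letter_of n (k, l)) {l. count K (letter_of n (k, l)) \<noteq> 0}"
      by (auto simp: inj_on_def letter_of_def)
  qed
  ultimately show ?thesis by (simp add: Theta_def Mm_eq_count[OF assms])
qed

lemma Theta_mset_Mm:
  assumes n: "n > 0" and len: "length v = length w"
  shows "Theta_mset n (Mm n v w) = pairs n v w"
proof (rule multiset_eqI)
  fix x
  show "count (Theta_mset n (Mm n v w)) x = count (pairs n v w) x"
  proof (cases "x \<in> Letters n")
    case True
    then show ?thesis
      by (simp add: count_Theta_mset[OF Mm_in_Theta[OF assms]] Mm_eq_count[OF assms] letter_of_Letters)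
  next
    case False
    then have "x \<notin># pairs n v w" using pairs_in_LMsets[OF n, of v w] by (auto simp: LMsets_def)
    then show ?thesis using False
      by (simp add: count_Theta_mset[OF Mm_in_Theta[OF assms]] not_in_iff)
  qed
qed

lemma Theta_mset_inj:
  assumes "n > 0" "B \<in> Theta n" "C \<in> Theta n"
  shows "Theta_mset n B = Theta_mset n C \<longleftrightarrow> B = C"
proof
  assume *: "Theta_mset n B = Theta_mset n C"
  show "B = C"
    using count_Theta_mset_letter[OF assms(2,1)] count_Theta_mset_letter[OF assms(3,1)]
    by (intro ext) (metis *)
qed simp

lemma Theta_mset_surj:
  assumes n: "n > 0" and "K \<in> LMsets n"
  obtains B where "B \<in> Theta n" "Theta_mset n B = K"
proof -
  obtain v w where "length v = length w" "pairs n v w = K" by (rule pairs_surj[OF assms(2)])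
  then show ?thesis using that[of "Mm n v w"] Mm_in_Theta[OF n] Theta_mset_Mm[OF n] by auto
qed

section \<open>Diagonal parts, and A[j] as a lifted monomial\<close>

lemma diagm_add_in_Theta:
  assumes "A \<in> ThetaPM n" "la \<in> NDelta n"
  shows "(\<lambda>k l. A k l + diagm la k l) \<in> Theta n"
proof -
  have "finite {l. A k l + diagm la k l \<noteq> 0}" for k
    by (rule finite_subset[of _ "{l. A k l \<noteq> 0} \<union> {k}"])
      (use assms in \<open>auto simp: ThetaPM_def Theta_def diagm_def split: if_splits\<close>)
  then show ?thesis using assms
    by (auto simp: ThetaPM_def Theta_def diagm_def NDelta_def)
qed

lemma Theta_split:
  assumes "B \<in> Theta n"
  obtains A la where "A \<in> ThetaPM n" "la \<in> NDelta n" "B = (\<lambda>k l. A k l + diagm la k l)"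
proof
  show "(\<lambda>k l. if k = l then 0 else B k l) \<in> ThetaPM n"
    using assms by (auto simp: ThetaPM_def Theta_def intro: rev_finite_subset)
  show "(\<lambda>k. B k k) \<in> NDelta n" using assms by (auto simp: Theta_def NDelta_def)
qed (auto simp: diagm_def fun_eq_iff)

lemma NDelta_eqI:
  assumes n: "n > 0" and "f \<in> NDelta n" "g \<in> NDelta n" and eq: "\<And>i. i \<in> {1..int n} \<Longrightarrow> f i = g i"
  shows "f = g"
proof
  fix i
  define i0 where "i0 = (i - 1) mod int n + 1"
  have i: "i0 + int n * ((i - 1) div int n) = i"
    using mult_div_mod_eq[of "int n" "i - 1"] unfolding i0_def by linarith
  have "f i = f i0" "g i = g i0"
    using assms periodic_int[of f n i0 "(i - 1) div int n"] periodic_int[of g n i0 "(i - 1) div int n"]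
    unfolding i by (auto simp: NDelta_def)
  moreover have "i0 \<in> {1..int n}"
    using n pos_mod_bound[of "int n" "i - 1"] pos_mod_sign[of "int n" "i - 1"]
    unfolding i0_def by (auto simp del: pos_mod_bound)
  ultimately show "f i = g i" using eq by simp
qed

text \<open>Needed to evaluate the sum in \<open>Aj\<close>, which would be 0 by convention over an
  infinite set. A periodic sequence is determined by its values on 1..n, and here these are at most
  m.\<close>

lemma finite_LambdaD:
  assumes n: "n > 0"
  shows "finite (LambdaD n m)"
proof (rule finite_imageD)
  let ?I = "{1..int n}"
  have "(\<lambda>la. restrict la ?I) ` LambdaD n m \<subseteq> (\<Pi>\<^sub>E i\<in>?I. {..m})"
  proof
    fix f assume "f \<in> (\<lambda>la. restrict la ?I) ` LambdaD n m"
    then obtain la where la: "la \<in> LambdaD n m" "f = restrict la ?I" by auto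
    have "la i \<le> m" if "i \<in> ?I" for i
      using member_le_sum[of i ?I la] that la by (auto simp: LambdaD_def)
    then show "f \<in> (\<Pi>\<^sub>E i\<in>?I. {..m})" using la by auto
  qed
  then show "finite ((\<lambda>la. restrict la ?I) ` LambdaD n m)"
    by (rule finite_subset) (simp add: finite_PiE)
  show "inj_on (\<lambda>la. restrict la ?I) (LambdaD n m)"
  proof (rule inj_onI, rule NDelta_eqI[OF n])
    show "f i = g i" if "restrict f ?I = restrict g ?I" "i \<in> ?I" for f g :: "int \<Rightarrow> nat" and i
      using that by (metis restrict_apply')
  qed (auto simp: LambdaD_def)
qed

text \<open>The diagonal carries the exponents j here, whereas in M(v,w) it carries the
  multiplicities lambda to which the exponents apply.\<close>

definition AIdx_mset :: "nat \<Rightarrow> zmat \<times> (int \<Rightarrow> nat) \<Rightarrow> (int \<times> int) multiset" where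
  "AIdx_mset n p = Theta_mset n (\<lambda>k l. fst p k l + diagm (snd p) k l)"

lemma offd_Theta_mset:
  assumes "A \<in> ThetaPM n" "la \<in> NDelta n"
  shows "offd (Theta_mset n (\<lambda>k l. A k l + diagm la k l)) = Theta_mset n A"
proof (rule multiset_eqI)
  fix x
  have "A \<in> Theta n" using assms by (simp add: ThetaPM_def)
  then show "count (offd (Theta_mset n (\<lambda>k l. A k l + diagm la k l))) x = count (Theta_mset n A) x"
    unfolding offd_def using assms
    by (auto simp: count_Theta_mset[OF diagm_add_in_Theta[OF assms]] count_Theta_mset ThetaPM_def)
      (simp_all add: diagm_def)
qed

lemma count_Theta_mset_diag:
  assumes "A \<in> ThetaPM n" "la \<in> NDelta n" "i \<in> {1..int n}"
  shows "count (Theta_mset n (\<lambda>k l. A k l + diagm la k l)) (i, i) = la i"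
  unfolding count_Theta_mset[OF diagm_add_in_Theta[OF assms(1,2)]]
  using assms by (simp add: diagm_def ThetaPM_def Letters_def)

lemma sigma_add_diagm:
  assumes "A \<in> ThetaPM n" "la \<in> NDelta n"
  shows "sigma n (\<lambda>k l. A k l + diagm la k l) = sigma n A + (\<Sum>i\<in>{1..int n}. la i)"
proof -
  have "(\<Sum>l | A k l + diagm la k l \<noteq> 0. A k l + diagm la k l) = (\<Sum>l | A k l \<noteq> 0. A k l) + la k" for k
  proof -
    have fin: "finite {l. A k l \<noteq> 0}" using assms by (auto simp: ThetaPM_def Theta_def)
    have "(\<Sum>l | A k l + diagm la k l \<noteq> 0. A k l + diagm la k l)
        = (\<Sum>l\<in>insert k {l. A k l \<noteq> 0}. A k l + diagm la k l)"
      using fin by (intro sum.mono_neutral_left) (auto simp: diagm_def split: if_splits)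
    also have "\<dots> = la k + (\<Sum>l | A k l \<noteq> 0. A k l + diagm la k l)"
      using fin assms by (subst sum.insert) (auto simp: diagm_def ThetaPM_def)
    also have "(\<Sum>l | A k l \<noteq> 0. A k l + diagm la k l) = (\<Sum>l | A k l \<noteq> 0. A k l)"
      using assms by (intro sum.cong) (auto simp: diagm_def ThetaPM_def)
    finally show ?thesis by simp
  qed
  then show ?thesis unfolding sigma_def by (simp add: sum.distrib)
qed

text \<open>For given v and w at most one lambda contributes to the sum, namely the diagonal of
  M(v,w), and it does so exactly when the off-diagonal part of M(v,w) is A. The sum collapses to the
  monomial of that diagonal.\<close>

lemma Aj_eq_bm:
  assumes n: "n > 0" and A: "A \<in> ThetaPM n" and j: "j \<in> NDelta n"
  shows "Aj n A j = bm n (AIdx_mset n (A, j))"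
proof (intro ext)
  fix v w
  define N where "N = pairs n v w"
  have bm: "bm n (AIdx_mset n (A, j)) v w = (if length v = length w then mon n (Theta_mset n A) j N else 0)"
    using count_Theta_mset_diag[OF A j]
    by (simp add: bm_def lift_def AIdx_mset_def offd_Theta_mset[OF A j] mon_def N_def)
  have AT: "A \<in> Theta n" using A by (simp add: ThetaPM_def)
  show "Aj n A j v w = bm n (AIdx_mset n (A, j)) v w"
  proof (cases "length v = length w")
    case False
    then show ?thesis unfolding bm by (simp add: Aj_def)
  next
    case len: True
    note MT = Mm_in_Theta[OF n len]
    have sizeN: "size N = length w" using len by (simp add: N_def size_pairs)
    have sM: "sigma n (Mm n v w) = length w"
      using size_Theta_mset[OF MT] Theta_mset_Mm[OF n len] sizeN by (simp add: N_def)
    have B1: "B1 n (\<lambda>k l. A k l + diagm la k l) v w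
        = (if Mm n v w = (\<lambda>k l. A k l + diagm la k l) then 1 else 0)" for la
      using sM len by (auto simp: B1_def)
    have NM: "Theta_mset n (Mm n v w) = N" using Theta_mset_Mm[OF n len] by (simp add: N_def)
    show ?thesis
    proof (cases "offd N = Theta_mset n A")
      case False
      have "Mm n v w \<noteq> (\<lambda>k l. A k l + diagm la k l)" if "la \<in> LambdaD n m" for la m
      proof
        assume "Mm n v w = (\<lambda>k l. A k l + diagm la k l)"
        then have "offd N = Theta_mset n A"
          using NM offd_Theta_mset[OF A, of la] that by (simp add: LambdaD_def)
        then show False using False by simp
      qed
      then show ?thesis using False unfolding bm by (auto simp: Aj_def B1 mon_def intro!: sum.neutral)
    next
      case True
      obtain A0 la0 where A0: "A0 \<in> ThetaPM n" "la0 \<in> NDelta n"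
        "Mm n v w = (\<lambda>k l. A0 k l + diagm la0 k l)"
        by (rule Theta_split[OF MT])
      have "Theta_mset n A0 = Theta_mset n A"
        using offd_Theta_mset[OF A0(1,2)] NM True A0(3) by simp
      then have "A0 = A" using Theta_mset_inj[OF n, of A0 A] A0(1) AT by (simp add: ThetaPM_def)
      note M = A0(3)[unfolded this] and la0 = A0(2)
      \<comment> \<open>Places \<open>la0\<close> in the index set of the sum and rules out
        truncation in \<open>length w - sigma n A\<close>.\<close>
      have len_eq: "length w = sigma n A + (\<Sum>i\<in>{1..int n}. la0 i)"
        using sM sigma_add_diagm[OF A la0] M by simp
      have "Mm n v w = (\<lambda>k l. A k l + diagm la k l) \<longleftrightarrow> la = la0" for la
        unfolding M by (auto simp: fun_eq_iff diagm_def)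
      then have "Aj n A j v w = (\<Sum>la\<in>LambdaD n (length w - sigma n A).
          if la = la0 then of_nat (mpow n la0 j) else 0)"
        unfolding Aj_def B1 using len len_eq by (auto intro!: sum.cong)
      also have "\<dots> = of_nat (mpow n la0 j)"
        using finite_LambdaD[OF n] la0 len_eq by (simp add: LambdaD_def)
      also have "\<dots> = mon n (Theta_mset n A) j N"
        using count_Theta_mset_diag[OF A la0] True unfolding NM[symmetric] M
        by (simp add: mon_def mpow_def)
      finally show ?thesis unfolding bm using len by simp
    qed
  qed
qed

lemma AIdx_mset_bij:
  assumes n: "n > 0"
  shows "bij_betw (AIdx_mset n) (AIdx n) (LMsets n)"
proof (rule bij_betwI')
  show "AIdx_mset n p \<in> LMsets n" if "p \<in> AIdx n" for p
    using that Theta_mset_in_LMsets diagm_add_in_Theta by (auto simp: AIdx_def AIdx_mset_def)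
  show "\<exists>p\<in>AIdx n. K = AIdx_mset n p" if K: "K \<in> LMsets n" for K
  proof -
    obtain B where B: "B \<in> Theta n" "Theta_mset n B = K" by (rule Theta_mset_surj[OF n K])
    obtain A la where "A \<in> ThetaPM n" "la \<in> NDelta n" "B = (\<lambda>k l. A k l + diagm la k l)"
      by (rule Theta_split[OF B(1)])
    then show ?thesis using B(2) by (intro bexI[of _ "(A, la)"]) (auto simp: AIdx_mset_def AIdx_def)
  qed
  show "AIdx_mset n p = AIdx_mset n q \<longleftrightarrow> p = q" if pq: "p \<in> AIdx n" "q \<in> AIdx n" for p q
  proof
    assume "AIdx_mset n p = AIdx_mset n q"
    then have eq: "fst p k l + diagm (snd p) k l = fst q k l + diagm (snd q) k l" for k l
      using pq Theta_mset_inj[OF n diagm_add_in_Theta diagm_add_in_Theta, of "fst p" "snd p" "fst q" "snd q"]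
      by (auto simp: AIdx_mset_def AIdx_def fun_eq_iff)
    have "snd p k = snd q k" for k using eq[of k k] pq by (auto simp: diagm_def AIdx_def ThetaPM_def)
    moreover have "fst p k l = fst q k l" for k l
      using eq[of k l] pq by (cases "k = l") (auto simp: diagm_def AIdx_def ThetaPM_def)
    ultimately show "p = q" by (simp add: prod_eq_iff fun_eq_iff)
  qed simp
qed

lemma Aspan_eq_span:
  assumes n: "n > 0"
  shows "Aspan n = msp.span (bm n ` LMsets n)"
proof -
  have "(\<lambda>p. Aj n (fst p) (snd p)) ` AIdx n = bm n ` AIdx_mset n ` AIdx n"
    unfolding image_image using Aj_eq_bm[OF n] by (intro image_cong) (auto simp: AIdx_def)
  also have "\<dots> = bm n ` LMsets n" using AIdx_mset_bij[OF n] by (simp add: bij_betw_def)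
  finally have "msp.span (bm n ` LMsets n) = msp.span ((\<lambda>p. Aj n (fst p) (snd p)) ` AIdx n)" by simp
  also have "\<dots> = Aspan n"
  proof -
    have "(\<Sum>p\<in>F. (\<lambda>v w. c p * Aj n (fst p) (snd p) v w)) = (\<lambda>v w. \<Sum>p\<in>F. c p * Aj n (fst p) (snd p) v w)"
      for F c
      by (intro ext) (simp add: sum_fun_apply)
    then show ?thesis unfolding msp.span_image_explicit Aspan_def by (simp add: conj_ac)
  qed
  finally show ?thesis by simp
qed

section \<open>Invariance under the affine symmetric groups, finiteness of columns, the
  identity\<close>

lemma length_act [simp]: "length (act n l w) = length l"
  by (simp add: act_def del: upt_Suc)

text \<open>\<open>act\<close> records only r values of the sequence composed with w. Since w
  commutes with the shift by r, extending these values by periodicity recovers the composition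
  everywhere.\<close>

lemma ext_act:
  assumes w: "w \<in> AffSym (length l)" and l: "l \<noteq> []"
  shows "ext n (act n l w) s = ext n l (w s)"
proof -
  define r where "r = length l"
  have r: "r > 0" using l by (simp add: r_def)
  define m where "m = (s - 1) mod int r"
  define q where "q = (s - 1) div int r"
  have m: "0 \<le> m" "m < int r" using r by (auto simp: m_def)
  have s: "s = (m + 1) + int r * q"
    using mult_div_mod_eq[of "int r" "s - 1"] unfolding m_def q_def by linarith
  \<comment> \<open>The function t -> w (k + t r) - t r has period 1, hence is constant.\<close>
  have "w (k + int r * t) - int r * t = w k" for k t
  proof -
    have "w (k + (t + 1) * int r) - (t + 1) * int r = w (k + t * int r) - t * int r" for t
    proof -
      have "w ((k + t * int r) + int r) = w (k + t * int r) + int r"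
        using w by (simp add: AffSym_def r_def)
      then show ?thesis by (simp add: distrib_right add.assoc)
    qed
    then have "(\<lambda>t. w (k + t * int r) - t * int r) (0 + int 1 * t) = (\<lambda>t. w (k + t * int r) - t * int r) 0"
      by (intro periodic_int) simp
    then show ?thesis by (simp add: mult.commute)
  qed
  from this[of "m + 1" q] have ws: "w s = w (m + 1) + int r * q" unfolding s by linarith
  have "act n l w ! nat m = ext n l (w (m + 1))"
    using m by (simp add: act_def r_def nat_less_iff add.commute del: upt_Suc)
  then have "ext n (act n l w) s = ext n l (w (m + 1)) + int n * q"
    by (simp add: ext_def[of n "act n l w"] r_def m_def q_def)
  also have "\<dots> = ext n l (w s)"
  proof -
    have "w s - 1 = (w (m + 1) - 1) + int r * q" using ws by simp
    then have "(w s - 1) mod int r = (w (m + 1) - 1) mod int r"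
      "(w s - 1) div int r = (w (m + 1) - 1) div int r + q"
      using r by (simp_all only: mod_mult_self2 div_mult_self2)
    then show ?thesis by (simp add: ext_def r_def distrib_left)
  qed
  finally show ?thesis .
qed

text \<open>Acting on both lists substitutes w s for s in the sets that are counted, and w is a
  bijection.\<close>

lemma Mm_act:
  assumes "length v = length u" "w \<in> AffSym (length u)"
  shows "Mm n (act n v w) (act n u w) = Mm n v u"
proof (cases "u = []")
  case True
  then show ?thesis using assms by (simp add: act_def)
next
  case False
  then have v: "v \<noteq> []" using assms by auto
  have bij: "bij w" using assms by (simp add: AffSym_def)
  have "bij_betw w {s. ext n v (w s) = k \<and> ext n u (w s) = l} {s. ext n v s = k \<and> ext n u s = l}" for k l
  proof (rule bij_betw_imageI)
    show "inj_on w {s. ext n v (w s) = k \<and> ext n u (w s) = l}"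
      using bij by (auto simp: bij_def inj_on_def)
    show "w ` {s. ext n v (w s) = k \<and> ext n u (w s) = l} = {s. ext n v s = k \<and> ext n u s = l}"
      using bij by (auto simp: bij_def surj_def image_iff)
  qed
  then have "card {s. ext n v (w s) = k \<and> ext n u (w s) = l} = card {s. ext n v s = k \<and> ext n u s = l}" for k l
    by (rule bij_betw_same_card)
  moreover have "act n v w \<noteq> []" using v length_act[of n v w] by force
  ultimately show ?thesis
    using ext_act[of w v] ext_act[of w u] False v assms by (simp add: Mm_def fun_eq_iff)
qed

text \<open>A nonzero entry fixes the off-diagonal letters, and a letter remembers the difference of
  its coordinates. So each v_s - w_s is 0 or the difference of some letter of K, which leaves
  finitely many v for a given w.\<close>

lemma finite_bm_column:
  "finite {v. bm n K v w \<noteq> 0}"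
proof (rule finite_subset)
  define D where "D = insert 0 ((\<lambda>y. fst y - snd y) ` set_mset K)"
  define S where "S = (\<lambda>(b, d). b + d) ` (set w \<times> D)"
  have "finite S" by (simp add: S_def D_def)
  then show "finite {v. set v \<subseteq> S \<and> length v = length w}" by (rule finite_lists_length_eq)
  show "{v. bm n K v w \<noteq> 0} \<subseteq> {v. set v \<subseteq> S \<and> length v = length w}"
  proof safe
    fix v assume "bm n K v w \<noteq> 0"
    then have len: "length v = length w" and off: "offd (pairs n v w) = offd K"
      by (auto simp: bm_def lift_def mon_def split: if_splits)
    then show "length v = length w" by simp
    fix a assume "a \<in> set v"
    then obtain m where m: "m < length v" "a = v ! m" by (auto simp: in_set_conv_nth)
    define b where "b = w ! m"
    have b: "b \<in> set w" using m len by (simp add: b_def)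
    have ab: "(a, b) \<in> set (zip v w)" using m len by (auto simp: set_zip b_def)
    have "a - b \<in> D"
    proof (cases "a = b")
      case False
      have "letter_of n (a, b) \<in># offd (pairs n v w)"
        using ab False by (auto simp: offd_def pairs_def)
      then have "letter_of n (a, b) \<in># K" unfolding off by (simp add: offd_def)
      moreover have "fst (letter_of n (a, b)) - snd (letter_of n (a, b)) = a - b"
        by (simp add: letter_of_diff)
      ultimately show ?thesis unfolding D_def by (intro insertI2 image_eqI[of _ _ "letter_of n (a, b)"]) simp_all
    qed (simp add: D_def)
    then show "a \<in> S" using b unfolding S_def by (intro image_eqI[of _ _ "(b, a - b)"]) auto
  qed
qed

lemma Aj_in_SchurProd:
  assumes n: "n > 0" and A: "A \<in> ThetaPM n" and j: "j \<in> NDelta n"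
  shows "Aj n A j \<in> SchurProd n"
proof -
  have "finite {v. Aj n A j v w \<noteq> 0}" for w
    unfolding Aj_eq_bm[OF assms] by (rule finite_bm_column)
  moreover have "Aj n A j (act n v w) (act n u w) = Aj n A j v u"
    if "length v = length u" "w \<in> AffSym (length u)" for v u w
    using Mm_act[OF that, of n] that by (simp add: Aj_def B1_def)
  ultimately show ?thesis by (auto simp: SchurProd_def blockmat_def Aj_def)
qed

text \<open>Without off-diagonal pairs v and w coincide, and all exponents are 0, so the monomial is
  1.\<close>

lemma idm_eq_bm: "idm = bm n {#}"
proof (intro ext)
  fix v w
  have "offd (pairs n v w) = {#} \<longleftrightarrow> v = w" if len: "length v = length w"
  proof
    assume *: "offd (pairs n v w) = {#}"
    have "v ! m = w ! m" if "m < length v" for m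
    proof (rule ccontr)
      assume ne: "v ! m \<noteq> w ! m"
      have "(v ! m, w ! m) \<in> set (zip v w)" using that len by (auto simp: set_zip)
      then have "letter_of n (v ! m, w ! m) \<in># offd (pairs n v w)"
        using ne by (auto simp: offd_def pairs_def)
      then show False using * by simp
    qed
    then show "v = w" using len by (simp add: list_eq_iff_nth_eq)
  next
    assume "v = w"
    then have "fst y = snd y" if "y \<in># pairs n v w" for y
      using that by (auto simp: pairs_def zip_same_conv_map)
    then show "offd (pairs n v w) = {#}" unfolding offd_def by (subst filter_mset_cong[OF refl, of _ _ "\<lambda>_. False"]) auto
  qed
  then show "idm v w = bm n {#} v w" by (auto simp: idm_def bm_def lift_def mon_def offd_def)
qed

section \<open>Linear independence\<close>

text \<open>Induction on the set of variables. With the other variables fixed, the sum is a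
  polynomial in the variable x that vanishes at all natural numbers, so each of its coefficients is
  0.\<close>

lemma monomials_independent:
  fixes c :: "'k \<Rightarrow> rat" and e :: "'k \<Rightarrow> 'i \<Rightarrow> nat"
  assumes "finite I" "finite F" "inj_on (\<lambda>k. restrict (e k) I) F"
    and "\<And>d :: 'i \<Rightarrow> nat. (\<Sum>k\<in>F. c k * (\<Prod>i\<in>I. of_nat (d i) ^ e k i)) = 0"
    and "k \<in> F"
  shows "c k = 0"
  using assms
proof (induction I arbitrary: F k rule: finite_induct)
  case empty
  have "F = {k}" using empty.prems by (auto simp: inj_on_def)
  then show ?case using empty.prems(3) by simp
next
  case (insert x I)
  \<comment> \<open>The terms that contribute to the coefficient of the power \<open>e k x\<close>.
    They share the exponent of x, so their exponents on \<open>I\<close> still separate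
    them.\<close>
  define G where "G = {k' \<in> F. e k' x = e k x}"
  have zero: "(\<Sum>k\<in>G. c k * (\<Prod>i\<in>I. of_nat (d i) ^ e k i)) = 0" for d :: "'i \<Rightarrow> nat"
  proof -
    define p where "p = (\<Sum>k\<in>F. monom (c k * (\<Prod>i\<in>I. of_nat (d i) ^ e k i)) (e k x))"
    have "poly p (of_nat t) = 0" for t
    proof -
      have "poly p (of_nat t) = (\<Sum>k\<in>F. c k * (\<Prod>i\<in>insert x I. of_nat ((d(x := t)) i) ^ e k i))"
      proof -
        have "(\<Prod>i\<in>I. of_nat (d i) ^ e k i :: rat) = (\<Prod>i\<in>I. of_nat ((d(x := t)) i) ^ e k i)" for k
          using insert.hyps by (intro prod.cong) auto
        then show ?thesis
          using insert.hyps by (simp add: p_def poly_sum poly_monom mult_ac)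
      qed
      then show ?thesis using insert.prems(3) by simp
    qed
    then have "range (of_nat :: nat \<Rightarrow> rat) \<subseteq> {x. poly p x = 0}" by auto
    moreover have "infinite (range (of_nat :: nat \<Rightarrow> rat))"
      by (rule range_inj_infinite) (auto simp: inj_on_def)
    ultimately have "p = 0" using poly_roots_finite[of p] finite_subset by blast
    then have "coeff p (e k x) = 0" by simp
    also have "coeff p (e k x) = (\<Sum>k\<in>G. c k * (\<Prod>i\<in>I. of_nat (d i) ^ e k i))"
      using insert.prems(1) by (simp add: p_def coeff_sum G_def sum.If_cases Int_def)
    finally show ?thesis .
  qed
  have inj: "inj_on (\<lambda>k. restrict (e k) I) G"
  proof (rule inj_onI)
    fix k1 k2 assume k: "k1 \<in> G" "k2 \<in> G" "restrict (e k1) I = restrict (e k2) I"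
    have "restrict (e k1) (insert x I) i = restrict (e k2) (insert x I) i" for i
      using k(1,2) fun_cong[OF k(3), of i] by (auto simp: G_def restrict_def split: if_splits)
    then show "k1 = k2" using insert.prems(2) k by (auto simp: inj_on_def G_def)
  qed
  show ?case
    by (rule insert.IH[OF _ inj zero]) (use insert.prems(1,4) in \<open>simp_all add: G_def\<close>)
qed

lemma LMsets_eqI:
  assumes "K \<in> LMsets n" "L \<in> LMsets n" "offd K = offd L"
    and "\<And>i. i \<in> {1..int n} \<Longrightarrow> count K (i, i) = count L (i, i)"
  shows "K = L"
proof (rule multiset_eqI)
  fix x
  show "count K x = count L x"
  proof (cases "fst x = snd x")
    case False
    then have "count K x = count (offd K) x" "count L x = count (offd L) x" by (auto simp: offd_def)
    then show ?thesis using assms(3) by simp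
  next
    case True
    show ?thesis
    proof (cases "x \<in> Letters n")
      case True
      then show ?thesis using assms(4)[of "fst x"] \<open>fst x = snd x\<close> by (cases x) (auto simp: Letters_def)
    next
      case False
      then have "x \<notin># K" "x \<notin># L" using assms by (auto simp: LMsets_def)
      then show ?thesis by (simp add: not_in_iff)
    qed
  qed
qed

text \<open>Used in both roles of a multiset: with multiplicities d as a point at which functions
  are evaluated, and with exponents j as the index of a basis element.\<close>

definition index_mset :: "nat \<Rightarrow> (int \<times> int) multiset \<Rightarrow> (int \<Rightarrow> nat) \<Rightarrow> (int \<times> int) multiset" where
  "index_mset n A d = A + (\<Sum>i\<in>{1..int n}. replicate_mset (d i) (i, i))"

lemma offd_index_mset:
  assumes "offd A = A"
  shows "offd (index_mset n A d) = A"
proof -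
  have "offd (\<Sum>i\<in>J. replicate_mset (d i) (i, i)) = {#}" for J
    by (induction J rule: infinite_finite_induct) (auto simp: offd_def)
  then show ?thesis using assms by (simp add: index_mset_def offd_def)
qed

lemma not_diag_in_offd: "offd A = A \<Longrightarrow> (i, i) \<notin># A"
proof
  assume "offd A = A" "(i, i) \<in># A"
  then have "(i, i) \<in># offd A" by simp
  then show False unfolding offd_def by simp
qed

lemma count_index_mset:
  assumes "offd A = A" "i \<in> {1..int n}"
  shows "count (index_mset n A d) (i, i) = d i"
proof -
  have "count (index_mset n A d) (i, i) = (\<Sum>k\<in>{1..int n}. if k = i then d k else 0)"
    using not_diag_in_offd[OF assms(1), of i] by (simp add: index_mset_def count_sum not_in_iff)
  then show ?thesis using assms(2) by simp
qed

lemma index_mset_in_LMsets: "A \<in> LMsets n \<Longrightarrow> index_mset n A d \<in> LMsets n"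
  by (auto simp: index_mset_def LMsets_def set_mset_sum Letters_def in_replicate_mset)

lemma size_index_mset: "size (index_mset n A d) = size A + (\<Sum>i\<in>{1..int n}. d i)"
proof -
  have "size (\<Sum>i\<in>J. replicate_mset (d i) (i, i)) = (\<Sum>i\<in>J. d i)" for J :: "int set"
    by (induction J rule: infinite_finite_induct) auto
  then show ?thesis by (simp add: index_mset_def)
qed

lemma offd_offd [simp]: "offd (offd K) = offd K"
  by (simp add: offd_def multiset_eq_iff)

lemma offd_in_LMsets: "K \<in> LMsets n \<Longrightarrow> offd K \<in> LMsets n"
  by (auto simp: offd_def LMsets_def)

lemma index_mset_offd:
  assumes "K \<in> LMsets n"
  shows "index_mset n (offd K) (\<lambda>i. count K (i, i)) = K"
  by (rule LMsets_eqI[OF _ assms])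
    (use assms in \<open>simp_all add: index_mset_in_LMsets offd_in_LMsets offd_index_mset count_index_mset\<close>)

lemma bm_index_mset: "offd A = A \<Longrightarrow> bm n (index_mset n A j) = lift n (mon n A j)"
  unfolding bm_def lift_def mon_def
  by (intro ext) (auto simp: offd_index_mset count_index_mset intro!: prod.cong)

text \<open>Evaluation at a multiset with off-diagonal part A kills all indices whose off-diagonal
  part is not A. The remaining ones differ in their exponents, and the diagonal multiplicities of
  the evaluation point can be prescribed freely.\<close>

lemma bm_independent:
  assumes F: "finite F" "F \<subseteq> LMsets n" and zero: "\<And>v w. (\<Sum>K\<in>F. c K * bm n K v w) = 0"
    and K0: "K0 \<in> F"
  shows "c K0 = 0"
proof -
  define A where "A = offd K0"
  define F0 where "F0 = {K \<in> F. offd K = A}"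
  have "(\<Sum>K\<in>F0. c K * (\<Prod>i\<in>{1..int n}. of_nat (d i) ^ count K (i, i))) = 0" for d :: "int \<Rightarrow> nat"
  proof -
    define N where "N = index_mset n A d"
    have A_off: "offd A = A" by (simp add: A_def)
    have cnt: "count N (i, i) = d i" if "i \<in> {1..int n}" for i
      using count_index_mset[OF A_off that] by (simp add: N_def)
    have offN: "offd N = A" using offd_index_mset[OF A_off] by (simp add: N_def)
    have "N \<in> LMsets n"
      unfolding N_def A_def using K0 F by (intro index_mset_in_LMsets offd_in_LMsets) auto
    then obtain v w where vw: "length v = length w" "pairs n v w = N" by (rule pairs_surj)
    have "bm n K v w = (if offd K = A then \<Prod>i\<in>{1..int n}. of_nat (d i) ^ count K (i, i) else 0)" for K
      using vw offN cnt by (auto simp: bm_def lift_def mon_def)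
    then have "(\<Sum>K\<in>F. c K * bm n K v w)
        = (\<Sum>K\<in>F0. c K * (\<Prod>i\<in>{1..int n}. of_nat (d i) ^ count K (i, i)))"
      unfolding F0_def using F(1) by (intro sum.mono_neutral_cong_right) auto
    then show ?thesis using zero by simp
  qed
  moreover have "inj_on (\<lambda>K. restrict (\<lambda>i. count K (i, i)) {1..int n}) F0"
  proof (rule inj_onI, rule LMsets_eqI)
    fix K L i
    assume "restrict (\<lambda>i. count K (i, i)) {1..int n} = restrict (\<lambda>i. count L (i, i)) {1..int n}"
      and i: "i \<in> {1..int n}"
    from fun_cong[OF this(1), of i] i show "count K (i, i) = count L (i, i)" by simp
  qed (use F in \<open>auto simp: F0_def\<close>)
  ultimately show ?thesis
    using F(1) K0 by (intro monomials_independent[of "{1..int n}" F0 "\<lambda>K i. count K (i, i)" c K0])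
      (auto simp: F0_def A_def)
qed

section \<open>The action of the letters\<close>

text \<open>Left multiplication by E_{i,k}, read from the target: v arises from u by a move at
  position s exactly if v_s is congruent to i modulo n and u is v with v_s replaced by v_s + k - i.
  This makes the matrix product a finite sum over the positions of v.\<close>

definition opM :: "nat \<Rightarrow> int \<times> int \<Rightarrow> mat \<Rightarrow> mat" where
  "opM n x Y = (\<lambda>v w. \<Sum>s | s < length v \<and> int n dvd v ! s - fst x.
      Y (v[s := v ! s + (snd x - fst x)]) w)"

definition colfin :: "mat \<Rightarrow> bool" where
  "colfin Y \<longleftrightarrow> (\<forall>w. finite {v. Y v w \<noteq> 0})"

lemma colfin_opM:
  assumes "colfin Y"
  shows "colfin (opM n x Y)"
  unfolding colfin_def
proof
  fix w
  let ?g = "\<lambda>(u, s). u[s := u ! s - (snd x - fst x)]"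
  have "{v. opM n x Y v w \<noteq> 0} \<subseteq> ?g ` (Sigma {u. Y u w \<noteq> 0} (\<lambda>u. {..<length u}))"
  proof
    fix v assume "v \<in> {v. opM n x Y v w \<noteq> 0}"
    then have "(\<Sum>s | s < length v \<and> int n dvd v ! s - fst x. Y (v[s := v ! s + (snd x - fst x)]) w) \<noteq> 0"
      by (simp add: opM_def)
    then obtain s where "s < length v" "Y (v[s := v ! s + (snd x - fst x)]) w \<noteq> 0"
      by (rule sum.not_neutral_contains_not_neutral) auto
    then show "v \<in> ?g ` (Sigma {u. Y u w \<noteq> 0} (\<lambda>u. {..<length u}))"
      by (intro image_eqI[of _ _ "(v[s := v ! s + (snd x - fst x)], s)"]) auto
  qed
  then show "finite {v. opM n x Y v w \<noteq> 0}"
    using assms by (auto simp: colfin_def intro: finite_subset)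
qed

lemma colfin_idm: "colfin idm"
  by (simp add: colfin_def idm_def)

text \<open>Finiteness of columns matters: \<open>mprod\<close> sums over the support of a column of
  \<open>Y\<close>, and over an infinite set that sum would be 0.\<close>

lemma mprod_etaE:
  assumes "colfin Y"
  shows "mprod (etaE n x) Y = opM n x Y"
proof (intro ext)
  fix v w
  define S where "S = {s. s < length v \<and> int n dvd v ! s - fst x}"
  define f where "f s = v[s := v ! s + (snd x - fst x)]" for s
  have S: "finite S" by (simp add: S_def)
  have supp: "finite {u. Y u w \<noteq> 0}" using assms by (simp add: colfin_def)
  have E: "etaE n x v u = (\<Sum>s\<in>S. if u = f s then 1 else 0)" for u
  proof -
    have "{s. s < length u \<and> (u ! s - snd x) mod int n = 0 \<and> v = u[s := fst x + (u ! s - snd x)]}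
        = {s \<in> S. u = f s}"
      by (auto simp: S_def f_def dvd_eq_mod_eq_0)
    then show ?thesis using S by (simp add: etaE_def sum.If_cases Int_def)
  qed
  have "mprod (etaE n x) Y v w = (\<Sum>s\<in>S. \<Sum>u | Y u w \<noteq> 0. if u = f s then Y u w else 0)"
    unfolding mprod_def E sum_distrib_right
    by (subst sum.swap) (intro sum.cong, auto)
  also have "\<dots> = (\<Sum>s\<in>S. Y (f s) w)"
    using supp by (intro sum.cong) (auto simp: sum.delta)
  also have "\<dots> = opM n x Y v w" by (simp add: opM_def S_def f_def)
  finally show "mprod (etaE n x) Y v w = opM n x Y v w" .
qed

lemma mprod_opM: "mprod (opM n x X) Y = opM n x (mprod X Y)"
  unfolding mprod_def opM_def sum_distrib_right by (intro ext sum.swap)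

lemma colfin_foldr_opM: "colfin Y \<Longrightarrow> colfin (foldr (opM n) ws Y)"
  by (induction ws) (auto simp: colfin_opM)

lemma eta_word_eq: "eta_word n ws = foldr (opM n) ws idm"
  by (induction ws) (auto simp: eta_word_def mprod_etaE colfin_foldr_opM colfin_idm)

text \<open>Turns a product into iterated letter operators applied to its right factor, which is how
  closure under products is obtained later.\<close>

lemma mprod_eta_word:
  assumes "colfin Y"
  shows "mprod (eta_word n ws) Y = foldr (opM n) ws Y"
proof (induction ws)
  case Nil
  have "(\<Sum>u | Y u w \<noteq> 0. (if v = u then 1 else 0) * Y u w) = Y v w" for v w
  proof -
    have "(\<Sum>u | Y u w \<noteq> 0. (if v = u then 1 else 0) * Y u w)
        = (\<Sum>u | Y u w \<noteq> 0. if v = u then Y u w else 0)"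
      by (intro sum.cong) auto
    then show ?thesis using assms by (auto simp: colfin_def sum.delta)
  qed
  then show ?case by (simp add: eta_word_eq mprod_def idm_def)
next
  case (Cons x ws)
  then show ?case by (simp add: eta_word_eq mprod_opM)
qed

lemma opM_add: "opM n x (X + Y) = opM n x X + opM n x Y"
  by (intro ext) (simp add: opM_def sum.distrib)

lemma opM_scale: "opM n x (\<lambda>v w. c * Y v w) = (\<lambda>v w. c * opM n x Y v w)"
  by (intro ext) (simp add: opM_def sum_distrib_left)

lemma foldr_opM_add: "foldr (opM n) ws (X + Y) = foldr (opM n) ws X + foldr (opM n) ws Y"
  by (induction ws) (simp_all only: foldr.simps id_apply comp_apply opM_add)

lemma foldr_opM_scale:
  "foldr (opM n) ws (\<lambda>v w. c * Y v w) = (\<lambda>v w. c * foldr (opM n) ws Y v w)"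
  by (induction ws) (auto simp: opM_scale)

text \<open>Terms that change two different positions cancel in the commutator; a term that changes the
  same position twice comes from the product of the two matrix units.\<close>
lemma opM_opM:
  "opM n x (opM n y Y) v w =
    (\<Sum>(s, t) | s < length v \<and> t < length v \<and> s \<noteq> t \<and> int n dvd v ! s - fst x \<and> int n dvd v ! t - fst y.
        Y (v[s := v ! s + (snd x - fst x), t := v ! t + (snd y - fst y)]) w)
    + (if int n dvd snd x - fst y then opM n (fst x, snd y + snd x - fst y) Y v w else 0)"
proof -
  define S where "S = {s. s < length v \<and> int n dvd v ! s - fst x}"
  define R where "R s = {t. t < length v \<and> s \<noteq> t \<and> int n dvd v ! t - fst y}" for s
  define g where "g s = v[s := v ! s + (snd x - fst x)]" for s
  \<comment> \<open>The contribution of t = s, where both letters act at one position and their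
    displacements add up.\<close>
  define h where "h s = (if int n dvd snd x - fst y then Y (v[s := v ! s + (snd x - fst x + (snd y - fst y))]) w else 0)" for s
  have inner: "opM n y Y (g s) w
      = (\<Sum>t\<in>R s. Y (v[s := v ! s + (snd x - fst x), t := v ! t + (snd y - fst y)]) w) + h s"
    if s: "s \<in> S" for s
  proof -
    have sl: "s < length v" and sd: "int n dvd v ! s - fst x" using s by (auto simp: S_def)
    \<comment> \<open>After the change at s, the entry there is congruent to \<open>snd x\<close>,
      so whether y applies at s depends only on x and y.\<close>
    have "int n dvd g s ! s - fst y \<longleftrightarrow> int n dvd snd x - fst y"
    proof -
      have "g s ! s - fst y = (snd x - fst y) + (v ! s - fst x)" using sl by (simp add: g_def)
      then show ?thesis using sd by (simp only: dvd_add_left_iff)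
    qed
    then have eq: "{t. t < length (g s) \<and> int n dvd g s ! t - fst y}
        = R s \<union> (if int n dvd snd x - fst y then {s} else {})"
      using sl by (auto simp: R_def g_def nth_list_update)
    have "opM n y Y (g s) w = (\<Sum>t\<in>R s. Y ((g s)[t := g s ! t + (snd y - fst y)]) w)
       + (\<Sum>t\<in>(if int n dvd snd x - fst y then {s} else {}). Y ((g s)[t := g s ! t + (snd y - fst y)]) w)"
      unfolding opM_def eq by (rule sum.union_disjoint) (auto simp: R_def)
    also have "(\<Sum>t\<in>R s. Y ((g s)[t := g s ! t + (snd y - fst y)]) w)
        = (\<Sum>t\<in>R s. Y (v[s := v ! s + (snd x - fst x), t := v ! t + (snd y - fst y)]) w)"
      by (intro sum.cong) (auto simp: R_def g_def)
    also have "(\<Sum>t\<in>(if int n dvd snd x - fst y then {s} else {}). Y ((g s)[t := g s ! t + (snd y - fst y)]) w) = h s"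
      using sl by (simp add: h_def g_def add.assoc)
    finally show ?thesis .
  qed
  have "opM n x (opM n y Y) v w = (\<Sum>s\<in>S. opM n y Y (g s) w)"
    by (simp add: opM_def[of n x] S_def g_def)
  also have "\<dots> = (\<Sum>s\<in>S. \<Sum>t\<in>R s. Y (v[s := v ! s + (snd x - fst x), t := v ! t + (snd y - fst y)]) w)
      + (\<Sum>s\<in>S. h s)"
    by (simp add: inner sum.distrib)
  also have "(\<Sum>s\<in>S. \<Sum>t\<in>R s. Y (v[s := v ! s + (snd x - fst x), t := v ! t + (snd y - fst y)]) w)
      = (\<Sum>(s, t)\<in>Sigma S R. Y (v[s := v ! s + (snd x - fst x), t := v ! t + (snd y - fst y)]) w)"
    by (rule sum.Sigma) (auto simp: S_def R_def)
  also have "Sigma S R = {(s, t). s < length v \<and> t < length v \<and> s \<noteq> t \<and> int n dvd v ! s - fst x \<and> int n dvd v ! t - fst y}"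
    by (auto simp: S_def R_def)
  also have "(\<Sum>s\<in>S. h s) = (if int n dvd snd x - fst y then opM n (fst x, snd y + snd x - fst y) Y v w else 0)"
    by (simp add: h_def opM_def S_def algebra_simps)
  finally show ?thesis .
qed

lemma opM_commutator:
  "opM n x (opM n y Y) v w - opM n y (opM n x Y) v w =
     (if int n dvd snd x - fst y then opM n (fst x, snd y + snd x - fst y) Y v w else 0)
   - (if int n dvd snd y - fst x then opM n (fst y, snd x + snd y - fst x) Y v w else 0)"
proof -
  have "(\<Sum>(s, t) | s < length v \<and> t < length v \<and> s \<noteq> t \<and> int n dvd v ! s - fst x \<and> int n dvd v ! t - fst y.
        Y (v[s := v ! s + (snd x - fst x), t := v ! t + (snd y - fst y)]) w)
    = (\<Sum>(s, t) | s < length v \<and> t < length v \<and> s \<noteq> t \<and> int n dvd v ! s - fst y \<and> int n dvd v ! t - fst x.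
        Y (v[s := v ! s + (snd y - fst y), t := v ! t + (snd x - fst x)]) w)"
    by (rule sum.reindex_bij_witness[where i = prod.swap and j = prod.swap])
      (auto simp: list_update_swap)
  then show ?thesis unfolding opM_opM by simp
qed

section \<open>Leading terms\<close>

lemma lift_add: "lift n (\<lambda>N. f N + g N) = lift n f + lift n g"
  by (intro ext) (simp add: lift_def)

lemma lift_scale: "lift n (\<lambda>N. c * f N) = (\<lambda>v w. c * lift n f v w)"
  by (intro ext) (simp add: lift_def)

lemma lift_sum: "lift n (\<lambda>N. \<Sum>i\<in>I. f i N) = (\<Sum>i\<in>I. lift n (f i))"
  by (intro ext) (simp add: lift_def sum_fun_apply)

lemma pairs_update:
  assumes "length v = length w" "s < length v"
  shows "pairs n (v[s := a]) w = pairs n v w - {#letter_of n (v ! s, w ! s)#} + {#letter_of n (a, w ! s)#}"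
proof -
  have "zip (v[s := a]) w = (zip v w)[s := (a, w ! s)]"
    by (simp add: update_zip)
  then have "pairs n (v[s := a]) w = mset ((map (letter_of n) (zip v w))[s := letter_of n (a, w ! s)])"
    by (simp add: pairs_def map_update flip: mset_map)
  also have "\<dots> = add_mset (letter_of n (a, w ! s)) (mset (map (letter_of n) (zip v w)) - {#letter_of n (v ! s, w ! s)#})"
    using assms by (subst mset_update) auto
  finally show ?thesis by (simp add: pairs_def)
qed

text \<open>On functions of M(v,w), left multiplication by E_{i,k} replaces one pair (i,b) by (k,b).\<close>
lemma opM_lift:
  assumes n: "n > 0" and x: "(i, k) \<in> Letters n"
  shows "opM n (i, k) (lift n f) = lift n (\<lambda>N. \<Sum>y | y \<in># N \<and> fst y = i.
           of_nat (count N y) * f (N - {#y#} + {#letter_of n (k, snd y)#}))"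
proof (intro ext)
  fix v w
  show "opM n (i, k) (lift n f) v w = lift n (\<lambda>N. \<Sum>y | y \<in># N \<and> fst y = i.
           of_nat (count N y) * f (N - {#y#} + {#letter_of n (k, snd y)#})) v w"
  proof (cases "length v = length w")
    case False
    then show ?thesis by (simp add: opM_def lift_def)
  next
    case len: True
    define N where "N = pairs n v w"
    define y where "y s = letter_of n (v ! s, w ! s)" for s
    define F where "F z = f (N - {#z#} + {#letter_of n (k, snd z)#})" for z
    define S where "S = {s. s < length v \<and> int n dvd v ! s - i}"
    have iL: "letter_of n (i, b) = (i, b)" for b
      using x by (intro letter_of_Letters) (auto simp: Letters_def)
    have y_eq: "y s = (i, w ! s - v ! s + i)" if "int n dvd v ! s - i" for s
      using letter_of_eq_iff[OF n, of "v ! s" "w ! s" i "w ! s - v ! s + i"] that iL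
      by (simp add: y_def)
    have dvd_iff: "int n dvd v ! s - i \<longleftrightarrow> fst (y s) = i" for s
    proof
      assume "fst (y s) = i"
      then have "letter_of n (v ! s, w ! s) = letter_of n (i, snd (y s))"
        unfolding iL by (simp add: prod_eq_iff flip: y_def)
      then show "int n dvd v ! s - i" using letter_of_eq_iff[OF n] by blast
    qed (simp add: y_eq)
    have step: "pairs n (v[s := v ! s + (k - i)]) w = N - {#y s#} + {#letter_of n (k, snd (y s))#}"
      if s: "s \<in> S" for s
    proof -
      have d: "int n dvd v ! s - i" "s < length v" using s by (auto simp: S_def)
      have "letter_of n (v ! s + (k - i), w ! s) = letter_of n (k, snd (y s))"
        using d y_eq[of s] by (subst letter_of_eq_iff[OF n]) simp
      then show ?thesis using pairs_update[OF len d(2)] by (simp add: N_def y_def)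
    qed
    have "opM n (i, k) (lift n f) v w = (\<Sum>s\<in>S. F (y s))"
      unfolding opM_def fst_conv snd_conv S_def[symmetric]
      using len step by (intro sum.cong) (simp_all add: lift_def F_def)
    \<comment> \<open>Positions are grouped by the letter that they carry; the letter z is carried
      by \<open>count N z\<close> positions.\<close>
    also have "\<dots> = (\<Sum>z\<in>y ` S. \<Sum>s | s \<in> S \<and> y s = z. F (y s))"
      by (rule sum.image_gen) (simp add: S_def)
    also have "\<dots> = (\<Sum>z\<in>y ` S. of_nat (count N z) * F z)"
    proof (rule sum.cong[OF refl])
      fix z assume "z \<in> y ` S"
      then have "fst z = i" by (auto simp: S_def dvd_iff)
      then have "{s. s \<in> S \<and> y s = z} = {s. s < length v \<and> y s = z}" by (auto simp: S_def dvd_iff)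
      then show "(\<Sum>s | s \<in> S \<and> y s = z. F (y s)) = of_nat (count N z) * F z"
        using count_pairs[OF len, of n z] by (simp add: N_def y_def)
    qed
    also have "y ` S = {z. z \<in># N \<and> fst z = i}"
    proof -
      have "set_mset N = y ` {..<length v}"
        using len by (force simp: N_def pairs_def set_zip y_def)
      then show ?thesis by (auto simp: S_def dvd_iff)
    qed
    finally show ?thesis using len by (simp add: lift_def N_def F_def)
  qed
qed

text \<open>The filtration by the degree sigma(A) + |j|. The bound is strict, so that d = 0 gives
  the zero space and inductions can start there.\<close>

definition Vlow :: "nat \<Rightarrow> nat \<Rightarrow> mat set" where
  "Vlow n d = msp.span (bm n ` {K \<in> LMsets n. size K < d})"

lemma subspace_Vlow: "msp.subspace (Vlow n d)"
  by (simp add: Vlow_def msp.subspace_span)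

lemma Vlow_mono: "d \<le> d' \<Longrightarrow> Vlow n d \<subseteq> Vlow n d'"
  unfolding Vlow_def by (intro msp.span_mono) auto

lemma lift_mon_in_Vlow:
  assumes "A \<in> LMsets n" "offd A = A" "size A + (\<Sum>i\<in>{1..int n}. j i) < d"
  shows "lift n (mon n A j) \<in> Vlow n d"
  unfolding Vlow_def bm_index_mset[OF assms(2), symmetric] using assms
  by (intro msp.span_base imageI) (simp add: index_mset_in_LMsets size_index_mset)

lemma prod_power_upd:
  fixes g :: "int \<Rightarrow> rat"
  assumes "finite I" "i \<in> I"
  shows "(\<Prod>a\<in>I. g a ^ (j(i := t)) a) = g i ^ t * (\<Prod>a\<in>I - {i}. g a ^ j a)"
  using assms by (subst prod.remove[of I i]) (auto intro!: prod.cong)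

lemma sum_upd:
  fixes j :: "int \<Rightarrow> nat"
  assumes "finite I" "i \<in> I"
  shows "(\<Sum>a\<in>I. (j(i := t)) a) + j i = (\<Sum>a\<in>I. j a) + t"
  using assms by (subst (1 2) sum.remove[of I i]) (auto intro!: sum.cong)

lemma mon_upd:
  assumes "i \<in> {1..int n}"
  shows "mon n A (j(i := t)) N = (if offd N = A then of_nat (count N (i, i)) ^ t *
     (\<Prod>a\<in>{1..int n} - {i}. of_nat (count N (a, a)) ^ j a) else 0)"
  unfolding mon_def using assms by (subst prod_power_upd) auto

text \<open>E_{i,i} exchanges each pair (i,b) for itself, so it multiplies by the number of pairs
  with first entry i. The diagonal ones raise the exponent at i by 1; the number of off-diagonal
  ones is a constant that depends on A only.\<close>

lemma opM_lift_mon_diag: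
  assumes n: "n > 0" and i: "i \<in> {1..int n}"
  shows "opM n (i, i) (lift n (mon n A j)) = lift n (mon n A (j(i := Suc (j i))))
    + (\<lambda>v w. (\<Sum>y | y \<in># A \<and> fst y = i \<and> fst y \<noteq> snd y. of_nat (count A y)) * lift n (mon n A j) v w)"
proof -
  define a :: rat where "a = (\<Sum>y | y \<in># A \<and> fst y = i \<and> fst y \<noteq> snd y. of_nat (count A y))"
  have iL: "(i, b) \<in> Letters n" for b using i by (auto simp: Letters_def)
  have "(\<Sum>y | y \<in># N \<and> fst y = i. of_nat (count N y) * mon n A j (N - {#y#} + {#letter_of n (i, snd y)#}))
      = mon n A (j(i := Suc (j i))) N + a * mon n A j N" for N
  proof -
    have "(\<Sum>y | y \<in># N \<and> fst y = i. of_nat (count N y) * mon n A j (N - {#y#} + {#letter_of n (i, snd y)#}))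
        = (\<Sum>y | y \<in># N \<and> fst y = i. of_nat (count N y) * mon n A j N)"
    proof (rule sum.cong[OF refl])
      fix y assume "y \<in> {y. y \<in># N \<and> fst y = i}"
      then have "letter_of n (i, snd y) = y" "y \<in># N" using letter_of_Letters[OF iL, of "snd y"] by auto
      then show "of_nat (count N y) * mon n A j (N - {#y#} + {#letter_of n (i, snd y)#})
          = of_nat (count N y) * mon n A j N" by simp
    qed
    also have "\<dots> = (\<Sum>y | y \<in># N \<and> fst y = i. of_nat (count N y)) * mon n A j N"
      by (simp add: sum_distrib_right)
    also have "\<dots> = of_nat (count N (i, i)) * mon n A j N + a * mon n A j N"
    proof (cases "offd N = A")
      case True
      have eq: "y \<in># A \<longleftrightarrow> y \<in># N" "count A y = count N y" if "fst y \<noteq> snd y" for y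
        using that True by (auto simp: offd_def)
      have "(\<Sum>y | y \<in># N \<and> fst y = i. of_nat (count N y))
          = (\<Sum>y\<in>insert (i, i) {y. y \<in># A \<and> fst y = i \<and> fst y \<noteq> snd y}. of_nat (count N y) :: rat)"
      proof (rule sum.mono_neutral_left)
        show "finite (insert (i, i) {y. y \<in># A \<and> fst y = i \<and> fst y \<noteq> snd y})"
          by (auto intro: finite_subset[of _ "set_mset A"])
      qed (use eq in \<open>auto simp: not_in_iff\<close>)
      also have "\<dots> = of_nat (count N (i, i)) + (\<Sum>y | y \<in># A \<and> fst y = i \<and> fst y \<noteq> snd y. of_nat (count N y))"
        by (subst sum.insert) (auto intro: finite_subset[of _ "set_mset A"])
      also have "(\<Sum>y | y \<in># A \<and> fst y = i \<and> fst y \<noteq> snd y. of_nat (count N y)) = a"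
        unfolding a_def by (intro sum.cong) (auto simp: eq(2))
      finally show ?thesis by (simp add: distrib_right)
    qed (simp add: mon_def)
    also have "of_nat (count N (i, i)) * mon n A j N = mon n A (j(i := Suc (j i))) N"
      using mon_upd[OF i, of A j "Suc (j i)" N] mon_upd[OF i, of A j "j i" N] by simp
    finally show ?thesis .
  qed
  then have "opM n (i, i) (lift n (mon n A j)) = lift n (\<lambda>N. mon n A (j(i := Suc (j i))) N + a * mon n A j N)"
    unfolding opM_lift[OF n iL] by (simp only:)
  then show ?thesis unfolding lift_add lift_scale a_def .
qed

section \<open>Exchanging one letter, and the action of E_{i,k} for i different from k\<close>

lemma add_diff_mset_eq_iff:
  assumes "y \<in># M"
  shows "M - {#y#} + {#z#} = A \<longleftrightarrow> z \<in># A \<and> M = A - {#z#} + {#y#}"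
proof -
  obtain M' where M': "M = add_mset y M'" using assms by (metis insert_DiffM)
  show ?thesis unfolding M' by (auto dest: multi_member_split)
qed

lemma in_offdD: "y \<in># offd N \<Longrightarrow> y \<in># N"
  by (simp add: offd_def)

lemma offd_exchange:
  assumes "y \<in># N"
  shows "offd (N - {#y#} + {#z#})
    = offd N - (if fst y = snd y then {#} else {#y#}) + (if fst z = snd z then {#} else {#z#})"
  using assms by (auto simp: offd_def multiset_eq_iff)

lemma count_exchange_diag:
  assumes "y \<in># N"
  shows "count (N - {#y#} + {#z#}) (a, a)
    = count N (a, a) - (if y = (a, a) then 1 else 0) + (if z = (a, a) then 1 else 0)"
  using assms by auto

text \<open>The three kinds of terms of E_{i,k} A[j]: the pair (i,k) becomes diagonal (leading term),
  the pair (i,i) becomes off-diagonal, or an off-diagonal pair stays off-diagonal.\<close>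
context
  fixes n :: nat and A :: "(int \<times> int) multiset" and j :: "int \<Rightarrow> nat" and i k :: int
  assumes n: "n > 0" and A: "A \<in> LMsets n" "offd A = A" and i: "i \<in> {1..int n}" and ik: "i \<noteq> k"
begin

private definition trm :: "int \<times> int \<Rightarrow> (int \<times> int) multiset \<Rightarrow> rat" where
  "trm y N = of_nat (count N y) * mon n A j (N - {#y#} + {#letter_of n (k, snd y)#})"

private lemma letter_k_off: "b \<noteq> k \<Longrightarrow> fst (letter_of n (k, b)) \<noteq> snd (letter_of n (k, b))"
  by simp

private lemma Letters_i: "(i, b) \<in> Letters n"
  using i by (simp add: Letters_def)

text \<open>Exchanging (i,k) for the diagonal pair raises its multiplicity X to X+1, and (X+1)^j is
  expanded by the binomial theorem. The top power gives the term subtracted here; each lower power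
  lowers the degree.\<close>

lemma trm_leading:
  "lift n (trm (i, k)) - (\<lambda>v w. of_nat (Suc (count A (i, k))) * lift n (mon n (add_mset (i, k) A) j) v w)
    \<in> Vlow n (Suc (size A + (\<Sum>a\<in>{1..int n}. j a)))"
proof -
  define x where "x = (i, k)"
  \<comment> \<open>k may lie outside 1..n, so the new diagonal pair (k,k) has to be normalised to a
    letter.\<close>
  obtain k0 where k0: "letter_of n (k, k) = (k0, k0)"
    using fst_eq_snd_letter_of[of n "(k, k)"] by (metis fst_conv snd_conv prod.collapse)
  have k0I: "k0 \<in> {1..int n}" using letter_of_in_Letters[OF n, of "(k, k)"] k0 by (simp add: Letters_def)
  define m :: "nat \<Rightarrow> (int \<times> int) multiset \<Rightarrow> rat" where "m t = mon n (add_mset x A) (j(k0 := t))" for t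
  define c :: "nat \<Rightarrow> rat" where "c t = of_nat (Suc (count A x)) * of_nat (j k0 choose t)" for t
  have trm: "trm x N = (\<Sum>t\<le>j k0. c t * m t N)" for N
  proof (cases "x \<in># N")
    case False
    then have "offd N \<noteq> add_mset x A" using in_offdD[of x N] by auto
    then show ?thesis using False by (simp add: trm_def m_def mon_def not_in_iff)
  next
    case True
    define N' where "N' = N - {#x#} + {#(k0, k0)#}"
    have "offd N' = offd N - {#x#}"
      unfolding N'_def offd_exchange[OF True] using ik by (simp add: x_def)
    moreover have "x \<in># offd N" using True ik by (simp add: offd_def x_def)
    ultimately have off: "offd N' = A \<longleftrightarrow> offd N = add_mset x A"
      by (metis add_mset_remove_trivial insert_DiffM)
    have cnt: "count N' (a, a) = count N (a, a) + (if a = k0 then 1 else 0)" for a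
      unfolding N'_def count_exchange_diag[OF True] using ik by (simp add: x_def)
    show ?thesis
    proof (cases "offd N = add_mset x A")
      case False
      then show ?thesis using off by (simp add: trm_def m_def mon_def x_def k0 N'_def)
    next
      case eq: True
      define P :: rat where "P = (\<Prod>a\<in>{1..int n} - {k0}. of_nat (count N (a, a)) ^ j a)"
      have cx: "count N x = Suc (count A x)"
      proof -
        have "count N x = count (offd N) x" using ik by (simp add: offd_def x_def)
        then show ?thesis using eq by simp
      qed
      have "mon n A j N' = mon n A (j(k0 := j k0)) N'" by simp
      also have "\<dots> = of_nat (count N (k0, k0) + 1) ^ j k0
          * (\<Prod>a\<in>{1..int n} - {k0}. of_nat (count N' (a, a)) ^ j a)"
        unfolding mon_upd[OF k0I] using off eq cnt by simp
      also have "(\<Prod>a\<in>{1..int n} - {k0}. of_nat (count N' (a, a)) ^ j a :: rat) = P"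
        unfolding P_def by (intro prod.cong) (auto simp: cnt)
      also have "of_nat (count N (k0, k0) + 1) ^ j k0
          = (\<Sum>t\<le>j k0. of_nat (j k0 choose t) * of_nat (count N (k0, k0)) ^ t :: rat)"
        unfolding of_nat_add binomial_ring by simp
      finally have "mon n A j N' = (\<Sum>t\<le>j k0. of_nat (j k0 choose t) * (of_nat (count N (k0, k0)) ^ t * P))"
        by (simp add: sum_distrib_right mult.assoc)
      also have "\<dots> = (\<Sum>t\<le>j k0. of_nat (j k0 choose t) * m t N)"
        unfolding m_def mon_upd[OF k0I] using eq by (simp add: P_def)
      finally have "trm x N = of_nat (Suc (count A x)) * (\<Sum>t\<le>j k0. of_nat (j k0 choose t) * m t N)"
        using cx k0 by (simp add: trm_def N'_def x_def)
      then show ?thesis by (simp add: c_def sum_distrib_left mult.assoc)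
    qed
  qed
  have "lift n (trm x) = (\<Sum>t\<le>j k0. (\<lambda>v w. c t * lift n (m t) v w))"
    unfolding trm lift_sum lift_scale ..
  also have "{..j k0} = insert (j k0) {..<j k0}" by auto
  also have "(\<Sum>t\<in>insert (j k0) {..<j k0}. (\<lambda>v w. c t * lift n (m t) v w))
      = (\<lambda>v w. c (j k0) * lift n (m (j k0)) v w) + (\<Sum>t<j k0. (\<lambda>v w. c t * lift n (m t) v w))"
    by (rule sum.insert) auto
  finally have "lift n (trm x) - (\<lambda>v w. c (j k0) * lift n (m (j k0)) v w)
      = (\<Sum>t<j k0. (\<lambda>v w. c t * lift n (m t) v w))" by simp
  moreover have "(\<Sum>t<j k0. (\<lambda>v w. c t * lift n (m t) v w)) \<in> Vlow n (Suc (size A + (\<Sum>a\<in>{1..int n}. j a)))"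
  proof (intro msp.subspace_sum msp.subspace_scale subspace_Vlow)
    fix t assume t: "t \<in> {..<j k0}"
    have "add_mset x A \<in> LMsets n" using A(1) Letters_i by (simp add: LMsets_def x_def)
    moreover have "offd (add_mset x A) = add_mset x A" using A(2) ik by (simp add: offd_def x_def)
    moreover have "(\<Sum>a\<in>{1..int n}. (j(k0 := t)) a) < (\<Sum>a\<in>{1..int n}. j a)"
      using sum_upd[OF _ k0I, of j t] t by simp
    ultimately show "lift n (m t) \<in> Vlow n (Suc (size A + (\<Sum>a\<in>{1..int n}. j a)))"
      unfolding m_def by (intro lift_mon_in_Vlow) (simp_all del: fun_upd_apply)
  qed
  ultimately show ?thesis by (simp add: c_def m_def x_def)
qed

text \<open>Removing (i,i) turns X into X-1, and X also counts the choices, so X(X-1)^j is expanded.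
  The exponent rises by at most 1, which the letter missing from A compensates.\<close>

lemma trm_diag: "lift n (trm (i, i)) \<in> Vlow n (Suc (size A + (\<Sum>a\<in>{1..int n}. j a)))"
proof -
  define y where "y = letter_of n (k, i)"
  have y_off: "fst y \<noteq> snd y" using ik by (simp add: y_def)
  define m :: "nat \<Rightarrow> (int \<times> int) multiset \<Rightarrow> rat" where "m t = mon n (A - {#y#}) (j(i := Suc t))" for t
  \<comment> \<open>If y is not in A, the new off-diagonal pair cannot fit and all terms vanish; the
    test is explicit because multiset subtraction would leave A unchanged.\<close>
  define c :: "nat \<Rightarrow> rat" where "c t = (if y \<in># A then of_nat (j i choose t) * (- 1) ^ (j i - t) else 0)" for t
  have trm: "trm (i, i) N = (\<Sum>t\<le>j i. c t * m t N)" for N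
  proof (cases "(i, i) \<in># N")
    case False
    \<comment> \<open>The exponent at i is \<open>Suc t\<close>, so a multiplicity 0 really gives
      0.\<close>
    then have "m t N = 0" for t unfolding m_def mon_upd[OF i] by (simp add: not_in_iff)
    then show ?thesis using False by (simp add: trm_def not_in_iff)
  next
    case True
    define N' where "N' = N - {#(i, i)#} + {#y#}"
    have "offd N' = add_mset y (offd N)"
      unfolding N'_def offd_exchange[OF True] using y_off by simp
    then have off: "offd N' = A \<longleftrightarrow> y \<in># A \<and> offd N = A - {#y#}"
      by (metis add_mset_remove_trivial insert_DiffM union_single_eq_member)
    have cnt: "count N' (a, a) = count N (a, a) - (if a = i then 1 else 0)" for a
      unfolding N'_def count_exchange_diag[OF True] using y_off by auto
    show ?thesis
    proof (cases "offd N' = A")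
      case False
      then have "(\<Sum>t\<le>j i. c t * m t N) = 0"
        using off by (intro sum.neutral) (auto simp: c_def m_def mon_def)
      then show ?thesis using False by (simp add: trm_def mon_def y_def N'_def)
    next
      case eq: True
      define P :: rat where "P = (\<Prod>a\<in>{1..int n} - {i}. of_nat (count N (a, a)) ^ j a)"
      define z :: rat where "z = of_nat (count N (i, i))"
      have z: "of_nat (count N' (i, i)) = z + (- 1)"
        using True by (simp add: cnt z_def of_nat_diff Suc_le_eq)
      have "mon n A j N' = mon n A (j(i := j i)) N'" by simp
      also have "\<dots> = (z + (- 1)) ^ j i * (\<Prod>a\<in>{1..int n} - {i}. of_nat (count N' (a, a)) ^ j a)"
        unfolding mon_upd[OF i] z using eq by simp
      also have "(\<Prod>a\<in>{1..int n} - {i}. of_nat (count N' (a, a)) ^ j a :: rat) = P"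
        unfolding P_def by (intro prod.cong) (auto simp: cnt)
      also have "(z + (- 1)) ^ j i = (\<Sum>t\<le>j i. of_nat (j i choose t) * z ^ t * (- 1) ^ (j i - t))"
        by (rule binomial_ring)
      finally have "trm (i, i) N = (\<Sum>t\<le>j i. of_nat (j i choose t) * (- 1) ^ (j i - t) * (z ^ Suc t * P))"
        by (simp add: trm_def z_def N'_def y_def sum_distrib_left sum_distrib_right mult_ac)
      also have "\<dots> = (\<Sum>t\<le>j i. c t * m t N)"
        unfolding m_def mon_upd[OF i] using eq off by (simp add: P_def z_def c_def)
      finally show ?thesis .
    qed
  qed
  show ?thesis
    unfolding trm lift_sum lift_scale
  proof (intro msp.subspace_sum subspace_Vlow)
    fix t assume t: "t \<in> {..j i}"
    show "(\<lambda>v w. c t * lift n (m t) v w) \<in> Vlow n (Suc (size A + (\<Sum>a\<in>{1..int n}. j a)))"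
    proof (cases "y \<in># A")
      case False
      then show ?thesis using msp.subspace_0[OF subspace_Vlow] by (simp add: c_def zero_fun_def)
    next
      case True
      have "A - {#y#} \<in> LMsets n" using A(1) by (auto simp: LMsets_def dest: in_diffD)
      moreover have "offd (A - {#y#}) = A - {#y#}"
        using A(2) y_off by (simp add: offd_def)
      moreover have "size (A - {#y#}) + (\<Sum>a\<in>{1..int n}. (j(i := Suc t)) a) < Suc (size A + (\<Sum>a\<in>{1..int n}. j a))"
        using sum_upd[OF _ i, of j "Suc t"] t size_Suc_Diff1[OF True] by (simp del: fun_upd_apply size_Suc_Diff1)
      ultimately have "lift n (m t) \<in> Vlow n (Suc (size A + (\<Sum>a\<in>{1..int n}. j a)))"
        unfolding m_def by (intro lift_mon_in_Vlow)
      then show ?thesis by (rule msp.subspace_scale[OF subspace_Vlow])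
    qed
  qed
qed

text \<open>The result is supported where the off-diagonal part is A with z exchanged for y. There
  the multiplicity of y is a constant, the diagonal does not change, and the size of A is
  preserved.\<close>

lemma trm_offdiag:
  assumes "b \<noteq> i" "b \<noteq> k" "letter_of n (k, b) \<in># A"
  shows "lift n (trm (i, b)) \<in> Vlow n (Suc (size A + (\<Sum>a\<in>{1..int n}. j a)))"
proof -
  define y where "y = (i, b)"
  define z where "z = letter_of n (k, b)"
  have y_off: "fst y \<noteq> snd y" and z_off: "fst z \<noteq> snd z" using assms by (auto simp: y_def z_def)
  define B where "B = add_mset y (A - {#z#})"
  have zA: "z \<in># A" using assms by (simp add: z_def)
  have trm: "trm y N = of_nat (count B y) * mon n B j N" for N
  proof (cases "y \<in># N")
    case False
    then have "offd N \<noteq> B" using in_offdD[of y N] by (auto simp: B_def)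
    then show ?thesis using False by (simp add: trm_def mon_def not_in_iff)
  next
    case True
    define N' where "N' = N - {#y#} + {#z#}"
    have yN: "y \<in># offd N" using True y_off by (simp add: offd_def)
    have "offd N' = offd N - {#y#} + {#z#}"
      unfolding N'_def offd_exchange[OF True] using y_off z_off by simp
    then have off: "offd N' = A \<longleftrightarrow> offd N = B"
      using add_diff_mset_eq_iff[OF yN, of z A] zA by (simp add: B_def)
    have cnt: "count N' (a, a) = count N (a, a)" for a
      unfolding N'_def count_exchange_diag[OF True] using y_off z_off by auto
    have cy: "count N y = count (offd N) y" using y_off by (simp add: offd_def)
    have "trm y N = of_nat (count N y) * mon n A j N'" by (simp add: trm_def y_def z_def N'_def)
    also have "\<dots> = of_nat (count B y) * mon n B j N"
      using off cnt cy by (simp add: mon_def)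
    finally show ?thesis .
  qed
  have "B \<in> LMsets n" using A(1) Letters_i by (auto simp: B_def y_def LMsets_def dest: in_diffD)
  moreover have "offd B = B"
    using A(2) y_off z_off by (simp add: offd_def B_def)
  moreover have "size B = size A" using zA by (simp add: B_def size_Suc_Diff1)
  ultimately have "lift n (mon n B j) \<in> Vlow n (Suc (size A + (\<Sum>a\<in>{1..int n}. j a)))"
    by (intro lift_mon_in_Vlow) simp_all
  then show ?thesis
    unfolding y_def[symmetric] trm lift_scale by (rule msp.subspace_scale[OF subspace_Vlow])
qed

text \<open>The sum in \<open>opM_lift\<close> ranges over a set that varies with N, so it must
  first be moved to a fixed finite set. For b outside \<open>insert k (insert i Z)\<close> the
  exchange creates an off-diagonal letter that A lacks, so the term vanishes.\<close>

lemma opM_lift_mon_offdiag: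
  "opM n (i, k) (lift n (mon n A j))
     - (\<lambda>v w. of_nat (Suc (count A (i, k))) * lift n (mon n (add_mset (i, k) A) j) v w)
    \<in> Vlow n (Suc (size A + (\<Sum>a\<in>{1..int n}. j a)))"
proof -
  define Z where "Z = {b. b \<noteq> i \<and> b \<noteq> k \<and> letter_of n (k, b) \<in># A}"
  have finZ: "finite Z"
  proof (rule finite_imageD)
    show "finite ((\<lambda>b. letter_of n (k, b)) ` Z)"
      by (rule finite_subset[of _ "set_mset A"]) (auto simp: Z_def)
    show "inj_on (\<lambda>b. letter_of n (k, b)) Z" by (auto simp: inj_on_def letter_of_def)
  qed
  have "(\<Sum>y | y \<in># N \<and> fst y = i. trm y N) = (\<Sum>b\<in>insert k (insert i Z). trm (i, b) N)" for N
  proof -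
    have "(\<Sum>y | y \<in># N \<and> fst y = i. trm y N) = (\<Sum>b | (i, b) \<in># N. trm (i, b) N)"
      by (rule sum.reindex_bij_witness[where i = "\<lambda>b. (i, b)" and j = snd]) auto
    also have "\<dots> = (\<Sum>b\<in>{b. (i, b) \<in># N} \<union> insert k (insert i Z). trm (i, b) N)"
    proof (rule sum.mono_neutral_left)
      have "finite {b. (i, b) \<in># N}"
        by (rule finite_subset[of _ "snd ` set_mset N"]) force+
      then show "finite ({b. (i, b) \<in># N} \<union> insert k (insert i Z))" using finZ by simp
    qed (auto simp: trm_def not_in_iff)
    also have "\<dots> = (\<Sum>b\<in>insert k (insert i Z). trm (i, b) N)"
    proof (rule sum.mono_neutral_right)
      have "finite {b. (i, b) \<in># N}"
        by (rule finite_subset[of _ "snd ` set_mset N"]) force+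
      then show "finite ({b. (i, b) \<in># N} \<union> insert k (insert i Z))" using finZ by simp
      show "\<forall>b\<in>({b. (i, b) \<in># N} \<union> insert k (insert i Z)) - insert k (insert i Z). trm (i, b) N = 0"
      proof
        fix b assume "b \<in> ({b. (i, b) \<in># N} \<union> insert k (insert i Z)) - insert k (insert i Z)"
        then have b: "b \<noteq> k" "letter_of n (k, b) \<notin># A" by (auto simp: Z_def)
        have "letter_of n (k, b) \<in># offd (N - {#(i, b)#} + {#letter_of n (k, b)#})"
          using letter_k_off[OF b(1)] by (simp add: offd_def)
        then have "offd (N - {#(i, b)#} + {#letter_of n (k, b)#}) \<noteq> A" using b by auto
        then show "trm (i, b) N = 0" by (simp add: trm_def mon_def)
      qed
    qed auto
    finally show ?thesis .
  qed
  then have "opM n (i, k) (lift n (mon n A j)) = (\<Sum>b\<in>insert k (insert i Z). lift n (trm (i, b)))"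
    unfolding opM_lift[OF n Letters_i] trm_def[symmetric] lift_sum[symmetric] by (simp only:)
  also have "\<dots> = lift n (trm (i, k)) + (\<Sum>b\<in>insert i Z. lift n (trm (i, b)))"
    using finZ ik by (subst sum.insert) (auto simp: Z_def)
  finally have eq: "opM n (i, k) (lift n (mon n A j))
      - (\<lambda>v w. of_nat (Suc (count A (i, k))) * lift n (mon n (add_mset (i, k) A) j) v w)
    = (lift n (trm (i, k))
      - (\<lambda>v w. of_nat (Suc (count A (i, k))) * lift n (mon n (add_mset (i, k) A) j) v w))
      + (\<Sum>b\<in>insert i Z. lift n (trm (i, b)))"
    by (simp only: add_diff_eq diff_add_eq)
  have "(\<Sum>b\<in>insert i Z. lift n (trm (i, b))) \<in> Vlow n (Suc (size A + (\<Sum>a\<in>{1..int n}. j a)))"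
    using trm_diag trm_offdiag by (intro msp.subspace_sum subspace_Vlow) (auto simp: Z_def)
  then show ?thesis
    unfolding eq by (intro msp.subspace_add[OF subspace_Vlow] trm_leading)
qed

end

lemma size_offd_diag:
  assumes "K \<in> LMsets n"
  shows "size (offd K) + (\<Sum>i\<in>{1..int n}. count K (i, i)) = size K"
  using size_index_mset[of n "offd K" "\<lambda>i. count K (i, i)"] index_mset_offd[OF assms] by simp

lemma opM_bm:
  assumes n: "n > 0" and K: "K \<in> LMsets n" and x: "x \<in> Letters n"
  obtains c where "c \<noteq> 0"
    "opM n x (bm n K) - (\<lambda>v w. c * bm n (add_mset x K) v w) \<in> Vlow n (Suc (size K))"
proof -
  obtain i k where xik: "x = (i, k)" by force
  have i: "i \<in> {1..int n}" using x xik by (simp add: Letters_def)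
  define A where "A = offd K"
  define j where "j = (\<lambda>i. count K (i, i))"
  have A: "A \<in> LMsets n" "offd A = A" using offd_in_LMsets[OF K] by (auto simp: A_def)
  have size: "size A + (\<Sum>a\<in>{1..int n}. j a) = size K"
    using size_offd_diag[OF K] by (simp add: A_def j_def)
  have bmK: "bm n K = lift n (mon n A j)" by (simp add: bm_def A_def j_def)
  show thesis
  proof (cases "i = k")
    case True
    have "offd (add_mset x K) = A" using True by (simp add: A_def offd_def xik)
    moreover have "(\<lambda>a. count (add_mset x K) (a, a)) = j(i := Suc (j i))"
      using True by (auto simp: j_def xik)
    ultimately have bmx: "bm n (add_mset x K) = lift n (mon n A (j(i := Suc (j i))))"
      unfolding bm_def by (simp only:)
    have "(\<lambda>v w. (\<Sum>y | y \<in># A \<and> fst y = i \<and> fst y \<noteq> snd y. of_nat (count A y)) * lift n (mon n A j) v w)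
        \<in> Vlow n (Suc (size K))"
      using A size by (intro msp.subspace_scale[OF subspace_Vlow] lift_mon_in_Vlow) auto
    then have "opM n x (bm n K) - bm n (add_mset x K) \<in> Vlow n (Suc (size K))"
      unfolding bmK bmx unfolding xik True[symmetric] opM_lift_mon_diag[OF n i] by simp
    then show thesis using that[of 1] by simp
  next
    case False
    have "offd (add_mset x K) = add_mset x A" using False by (simp add: A_def offd_def xik)
    moreover have "(\<lambda>a. count (add_mset x K) (a, a)) = j"
      using False by (auto simp: j_def xik)
    ultimately have bmx: "bm n (add_mset x K) = lift n (mon n (add_mset x A) j)"
      unfolding bm_def by (simp only:)
    show thesis
      by (rule that[of "of_nat (Suc (count A x))"])
        (use opM_lift_mon_offdiag[OF n A i False, of j] in \<open>simp_all only: bmK bmx[unfolded xik] xik size of_nat_eq_0_iff nat.simps not_False_eq_True\<close>)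
  qed
qed

lemma opM_Vlow:
  assumes n: "n > 0" and x: "x \<in> Letters n" and Y: "Y \<in> Vlow n d"
  shows "opM n x Y \<in> Vlow n (Suc d)"
  using Y unfolding Vlow_def[of n d]
proof (induction rule: msp.span_induct_alt)
  case base
  have "opM n x 0 = 0" by (intro ext) (simp add: opM_def)
  then show ?case using msp.subspace_0[OF subspace_Vlow] by (simp only:)
next
  case (step c X Y)
  then obtain K where K: "K \<in> LMsets n" "size K < d" "X = bm n K" by auto
  obtain a where "opM n x (bm n K) - (\<lambda>v w. a * bm n (add_mset x K) v w) \<in> Vlow n (Suc (size K))"
    by (rule opM_bm[OF n K(1) x])
  moreover have "Vlow n (Suc (size K)) \<subseteq> Vlow n (Suc d)" using K by (intro Vlow_mono) simp
  ultimately have 1: "opM n x (bm n K) - (\<lambda>v w. a * bm n (add_mset x K) v w) \<in> Vlow n (Suc d)" by blast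
  have "bm n (add_mset x K) \<in> Vlow n (Suc d)"
    unfolding Vlow_def using K x by (intro msp.span_base imageI) (simp add: LMsets_def)
  then have "(\<lambda>v w. a * bm n (add_mset x K) v w) \<in> Vlow n (Suc d)"
    by (rule msp.subspace_scale[OF subspace_Vlow])
  from msp.subspace_add[OF subspace_Vlow 1 this] have "opM n x X \<in> Vlow n (Suc d)"
    by (simp only: K(3) diff_add_cancel)
  then show ?case
    unfolding opM_add opM_scale
    by (intro msp.subspace_add[OF subspace_Vlow] msp.subspace_scale[OF subspace_Vlow] step.IH)
qed

section \<open>Leading terms of words\<close>

lemma mset_in_LMsets [simp]: "mset ws \<in> LMsets n \<longleftrightarrow> set ws \<subseteq> Letters n"
  by (simp add: LMsets_def)

text \<open>Leading coefficients multiply along the word. A new letter raises the old error by one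
  degree at most and adds the error of \<open>opM_bm\<close>, and both fit below the new
  length.\<close>

lemma eta_word_leading:
  assumes n: "n > 0" and "set ws \<subseteq> Letters n"
  shows "\<exists>c. c \<noteq> 0 \<and> eta_word n ws - (\<lambda>v w. c * bm n (mset ws) v w) \<in> Vlow n (length ws)"
  using assms(2)
proof (induction ws)
  case Nil
  have "eta_word n [] - (\<lambda>v w. 1 * bm n (mset []) v w) = 0"
    using idm_eq_bm[of n] by (intro ext) (simp add: eta_word_eq)
  then show ?case using msp.subspace_0[OF subspace_Vlow]
    by (intro exI[of _ 1] conjI) (simp_all only: one_neq_zero not_False_eq_True)
next
  case (Cons x ws)
  then have xw: "x \<in> Letters n" "set ws \<subseteq> Letters n" by auto
  from Cons.IH[OF xw(2)] obtain c where c: "c \<noteq> 0"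
    "eta_word n ws - (\<lambda>v w. c * bm n (mset ws) v w) \<in> Vlow n (length ws)"
    by blast
  define r where "r = eta_word n ws - (\<lambda>v w. c * bm n (mset ws) v w)"
  obtain c' where c': "c' \<noteq> 0" "opM n x (bm n (mset ws)) - (\<lambda>v w. c' * bm n (add_mset x (mset ws)) v w)
      \<in> Vlow n (Suc (size (mset ws)))"
    by (rule opM_bm[OF n mset_in_LMsets[THEN iffD2, OF xw(2)] xw(1)])
  define s where "s = opM n x (bm n (mset ws)) - (\<lambda>v w. c' * bm n (add_mset x (mset ws)) v w)"
  have "eta_word n (x # ws) = opM n x (eta_word n ws)" by (simp add: eta_word_eq)
  also have "eta_word n ws = r + (\<lambda>v w. c * bm n (mset ws) v w)" by (simp only: r_def diff_add_cancel)
  also have "opM n x \<dots> = opM n x r + (\<lambda>v w. c * opM n x (bm n (mset ws)) v w)"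
    unfolding opM_add opM_scale ..
  also have "opM n x (bm n (mset ws)) = s + (\<lambda>v w. c' * bm n (add_mset x (mset ws)) v w)"
    by (simp only: s_def diff_add_cancel)
  finally have eq: "eta_word n (x # ws)
    = opM n x r + (\<lambda>v w. c * (s + (\<lambda>v w. c' * bm n (add_mset x (mset ws)) v w)) v w)" .
  have "eta_word n (x # ws) - (\<lambda>v w. (c * c') * bm n (mset (x # ws)) v w)
      = opM n x r + (\<lambda>v w. c * s v w)"
  proof (intro ext)
    fix v w
    show "(eta_word n (x # ws) - (\<lambda>v w. (c * c') * bm n (mset (x # ws)) v w)) v w
      = (opM n x r + (\<lambda>v w. c * s v w)) v w"
      unfolding minus_apply plus_fun_apply eq mset.simps distrib_left mult.assoc by simp
  qed
  also have "\<dots> \<in> Vlow n (length (x # ws))"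
  proof (intro msp.subspace_add[OF subspace_Vlow] msp.subspace_scale[OF subspace_Vlow])
    show "opM n x r \<in> Vlow n (length (x # ws))" using opM_Vlow[OF n xw(1) c(2)[folded r_def]] by simp
    show "s \<in> Vlow n (length (x # ws))" using c'(2)[folded s_def] by simp
  qed
  finally have "eta_word n (x # ws) - (\<lambda>v w. (c * c') * bm n (mset (x # ws)) v w) \<in> Vlow n (length (x # ws))" .
  moreover have "c * c' \<noteq> 0" using c(1) c'(1) by simp
  ultimately show ?case by blast
qed

lemma eta_word_in_Vlow:
  assumes n: "n > 0" and ws: "set ws \<subseteq> Letters n"
  shows "eta_word n ws \<in> Vlow n (Suc (length ws))"
proof -
  obtain c where "eta_word n ws - (\<lambda>v w. c * bm n (mset ws) v w) \<in> Vlow n (length ws)"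
    using eta_word_leading[OF assms] by blast
  then have 1: "eta_word n ws - (\<lambda>v w. c * bm n (mset ws) v w) \<in> Vlow n (Suc (length ws))"
    using Vlow_mono[of "length ws" "Suc (length ws)" n] by auto
  have "bm n (mset ws) \<in> Vlow n (Suc (length ws))"
    unfolding Vlow_def using ws by (intro msp.span_base imageI) simp
  then have "(\<lambda>v w. c * bm n (mset ws) v w) \<in> Vlow n (Suc (length ws))"
    by (rule msp.subspace_scale[OF subspace_Vlow])
  from msp.subspace_add[OF subspace_Vlow 1 this] show ?thesis by (simp only: diff_add_cancel)
qed

lemma Vlow_subset_Aspan: "n > 0 \<Longrightarrow> Vlow n d \<subseteq> Aspan n"
  unfolding Vlow_def Aspan_eq_span by (intro msp.span_mono) auto

lemma Aspan_in_Vlow: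
  assumes n: "n > 0" and X: "X \<in> Aspan n"
  shows "\<exists>d. X \<in> Vlow n d"
  using X unfolding Aspan_eq_span[OF n]
proof (induction rule: msp.span_induct_alt)
  case base
  show ?case using msp.subspace_0[OF subspace_Vlow] by blast
next
  case (step c X Y)
  then obtain d K where d: "Y \<in> Vlow n d" and K: "K \<in> LMsets n" "X = bm n K" by auto
  define e where "e = max d (Suc (size K))"
  have "X \<in> Vlow n e" unfolding Vlow_def e_def using K by (auto intro!: msp.span_base imageI)
  moreover have "Y \<in> Vlow n e" using d Vlow_mono[of d e n] by (auto simp: e_def)
  ultimately show ?case
    using msp.subspace_add[OF subspace_Vlow msp.subspace_scale[OF subspace_Vlow]] by blast
qed

text \<open>Independence in degree d modulo lower degrees. The two index sets are disjoint by size,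
  so one relation with coefficients a and -b falls under \<open>bm_independent\<close>.\<close>

lemma bm_leading_zero:
  assumes F: "finite F" "F \<subseteq> {K \<in> LMsets n. size K = d}"
    and low: "(\<Sum>K\<in>F. (\<lambda>v w. a K * bm n K v w)) \<in> Vlow n d" and K0: "K0 \<in> F"
  shows "a K0 = 0"
proof -
  from low obtain G b where G: "finite G" "G \<subseteq> {K \<in> LMsets n. size K < d}"
    "(\<Sum>K\<in>F. (\<lambda>v w. a K * bm n K v w)) = (\<Sum>K\<in>G. (\<lambda>v w. b K * bm n K v w))"
    unfolding Vlow_def msp.span_image_explicit by auto
  define c where "c K = (if K \<in> F then a K else - b K)" for K
  have disj: "F \<inter> G = {}" using F(2) G(2) by auto
  have "(\<Sum>K\<in>F \<union> G. c K * bm n K v w) = 0" for v w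
  proof -
    have "(\<Sum>K\<in>F \<union> G. c K * bm n K v w) = (\<Sum>K\<in>F. c K * bm n K v w) + (\<Sum>K\<in>G. c K * bm n K v w)"
      using F(1) G(1) disj by (rule sum.union_disjoint)
    also have "(\<Sum>K\<in>F. c K * bm n K v w) = (\<Sum>K\<in>F. a K * bm n K v w)" by (simp add: c_def)
    also have "(\<Sum>K\<in>G. c K * bm n K v w) = - (\<Sum>K\<in>G. b K * bm n K v w)"
      unfolding sum_negf[symmetric] using disj by (intro sum.cong) (auto simp: c_def)
    also have "(\<Sum>K\<in>F. a K * bm n K v w) = (\<Sum>K\<in>G. b K * bm n K v w)"
      using fun_cong[OF fun_cong[OF G(3), of v], of w] by (simp add: sum_fun_apply)
    finally show ?thesis by simp
  qed
  from bm_independent[OF _ _ this, of K0] F G K0 have "c K0 = 0" by auto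
  then show ?thesis using K0 by (simp add: c_def)
qed

section \<open>The tensor algebra and its relations\<close>

definition wd :: "(int \<times> int) list \<Rightarrow> (int \<times> int) list \<Rightarrow> rat" where
  "wd u = (\<lambda>w. if w = u then 1 else 0)"

lemma wd_in_Tfin: "set u \<subseteq> Letters n \<Longrightarrow> wd u \<in> Tfin n"
  by (auto simp: Tfin_def wd_def)

lemma subspace_Tfin: "fsp.subspace (Tfin n)"
proof (rule fsp.subspaceI)
  show "0 \<in> Tfin n" by (simp add: Tfin_def)
next
  fix f g assume "f \<in> Tfin n" "g \<in> Tfin n"
  then have "finite ({w. f w \<noteq> 0} \<union> {w. g w \<noteq> 0})"
    and supp: "\<And>w. f w \<noteq> 0 \<or> g w \<noteq> 0 \<Longrightarrow> set w \<subseteq> Letters n"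
    by (auto simp: Tfin_def)
  moreover have "\<forall>w. (f + g) w \<noteq> 0 \<longrightarrow> set w \<subseteq> Letters n"
  proof (intro allI impI supp)
    show "f w \<noteq> 0 \<or> g w \<noteq> 0" if "(f + g) w \<noteq> 0" for w using that by auto
  qed
  moreover have "{w. (f + g) w \<noteq> 0} \<subseteq> {w. f w \<noteq> 0} \<union> {w. g w \<noteq> 0}" by auto
  ultimately show "f + g \<in> Tfin n" unfolding Tfin_def using finite_subset by blast
next
  fix c f assume "f \<in> Tfin n"
  then show "(\<lambda>w. c * f w) \<in> Tfin n"
    by (auto simp: Tfin_def intro: rev_finite_subset)
qed

lemma eta_superset:
  assumes "finite S" "{w. f w \<noteq> 0} \<subseteq> S"
  shows "eta n f v u = (\<Sum>w\<in>S. f w * eta_word n w v u)"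
  unfolding eta_def using assms by (intro sum.mono_neutral_left) auto

lemma eta_add:
  assumes "f \<in> Tfin n" "g \<in> Tfin n"
  shows "eta n (f + g) = eta n f + eta n g"
proof (intro ext)
  fix v u
  define S where "S = {w. f w \<noteq> 0} \<union> {w. g w \<noteq> 0}"
  have S: "finite S" using assms by (simp add: S_def Tfin_def)
  have "eta n f v u = (\<Sum>w\<in>S. f w * eta_word n w v u)"
    "eta n g v u = (\<Sum>w\<in>S. g w * eta_word n w v u)"
    "eta n (f + g) v u = (\<Sum>w\<in>S. (f + g) w * eta_word n w v u)"
    by (rule eta_superset[OF S], force simp: S_def)+
  then show "eta n (f + g) v u = (eta n f + eta n g) v u"
    by (simp add: distrib_right sum.distrib)
qed

lemma eta_scale: "eta n (\<lambda>w. c * f w) = (\<lambda>v u. c * eta n f v u)"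
  by (cases "c = 0") (simp_all add: eta_def sum_distrib_left mult.assoc)

lemma eta_wd: "eta n (wd u) = eta_word n u"
  by (intro ext) (simp add: eta_def wd_def)

lemma eta_zero: "eta n 0 = 0"
  by (intro ext) (simp add: eta_def)

lemma eta_diff:
  assumes "f \<in> Tfin n" "g \<in> Tfin n"
  shows "eta n (f - g) = eta n f - eta n g"
proof -
  have "f - g \<in> Tfin n" using assms fsp.subspace_diff[OF subspace_Tfin] by blast
  then have "eta n ((f - g) + g) = eta n (f - g) + eta n g" using assms by (intro eta_add)
  then show ?thesis by (simp only: diff_add_cancel add_diff_cancel_right')
qed

lemma eta_sum:
  assumes "\<And>i. i \<in> I \<Longrightarrow> f i \<in> Tfin n"
  shows "eta n (\<Sum>i\<in>I. f i) = (\<Sum>i\<in>I. eta n (f i))"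
  using assms
proof (induction I rule: infinite_finite_induct)
  case (insert i I)
  have "(\<Sum>i\<in>I. f i) \<in> Tfin n"
    using insert.prems by (intro fsp.subspace_sum subspace_Tfin) auto
  then show ?case using insert by (simp only: sum.insert eta_add insert_iff simp_thms)
qed (simp_all only: sum.infinite sum.empty eta_zero not_False_eq_True)

lemma Tfin_expand:
  assumes "f \<in> Tfin n"
  shows "f = (\<Sum>u | f u \<noteq> 0. (\<lambda>w. f u * wd u w))"
proof
  fix w
  have "(\<Sum>u | f u \<noteq> 0. f u * wd u w) = (\<Sum>u | f u \<noteq> 0. if u = w then f u else 0)"
    by (intro sum.cong) (auto simp: wd_def)
  also have "\<dots> = f w" using assms by (auto simp: Tfin_def)
  finally show "f w = (\<Sum>u | f u \<noteq> 0. (\<lambda>w. f u * wd u w)) w" by (simp add: sum_fun_apply)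
qed

section \<open>The defining relations and their image under eta\<close>

definition rel_idx :: "nat \<Rightarrow> ((int \<times> int) list \<times> (int \<times> int) \<times> (int \<times> int) \<times> (int \<times> int) list) set" where
  "rel_idx n = {(u, x, y, v). set u \<subseteq> Letters n \<and> x \<in> Letters n \<and> y \<in> Letters n \<and> set v \<subseteq> Letters n}"

lemma Irel_eq_span: "Irel n = fsp.span (relgen n ` rel_idx n)"
proof -
  have "(\<Sum>q\<in>F. (\<lambda>w. c q * relgen n q w)) = (\<lambda>w. \<Sum>q\<in>F. c q * relgen n q w)" for F c
    by (intro ext) (simp add: sum_fun_apply)
  then show ?thesis
    unfolding fsp.span_image_explicit Irel_def rel_idx_def by (simp add: conj_ac)
qed

text \<open>The product of two periodic matrix units is again a matrix unit or 0. A row with index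
  in 1..n of E_x has at most one nonzero entry, because two numbers in 1..n that differ by a
  multiple of n are equal.\<close>

lemma zmul_Emat:
  assumes x: "x \<in> Letters n" and z: "z \<in> Letters n"
  shows "zmul (Emat n x) (Emat n y) (fst z) (snd z)
    = (if int n dvd snd x - fst y \<and> z = (fst x, snd y + snd x - fst y) then 1 else 0)"
proof -
  have E: "Emat n x (fst z) c = (if fst z = fst x \<and> c = snd x then 1 else 0)" for c
  proof -
    have "t = 0" if "fst z = fst x + t * int n" for t
    proof -
      have "\<bar>t * int n\<bar> < int n" using x z that by (auto simp: Letters_def)
      then have "\<bar>t\<bar> * int n < 1 * int n" by (simp add: abs_mult)
      then have "\<bar>t\<bar> < 1" by (simp only: mult_less_cancel_right)
      then show ?thesis by simp
    qed
    then have "(\<exists>t. fst z = fst x + t * int n \<and> c = snd x + t * int n) \<longleftrightarrow> fst z = fst x \<and> c = snd x"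
      by (auto intro: exI[of _ 0])
    then show ?thesis by (simp add: Emat_def)
  qed
  have "zmul (Emat n x) (Emat n y) (fst z) (snd z)
      = (if fst z = fst x then Emat n y (snd x) (snd z) else 0)"
    by (simp add: zmul_def E)
  also have "Emat n y (snd x) (snd z) = (if int n dvd snd x - fst y \<and> snd z = snd y + snd x - fst y then 1 else 0)"
  proof -
    have "(\<exists>t. snd x = fst y + t * int n \<and> snd z = snd y + t * int n)
        \<longleftrightarrow> int n dvd snd x - fst y \<and> snd z = snd y + snd x - fst y"
    proof
      assume "int n dvd snd x - fst y \<and> snd z = snd y + snd x - fst y"
      moreover then obtain t where "snd x - fst y = int n * t" by (auto elim: dvdE)
      ultimately show "\<exists>t. snd x = fst y + t * int n \<and> snd z = snd y + t * int n"
        by (intro exI[of _ t]) (simp add: mult.commute)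
    qed auto
    then show ?thesis by (simp add: Emat_def)
  qed
  finally show ?thesis by (auto simp: prod_eq_iff)
qed

text \<open>One half of a bracket placed between u and v: b tells whether the product of the two
  matrix units is nonzero, and z is the resulting letter.\<close>

definition mid :: "(int \<times> int) list \<Rightarrow> bool \<Rightarrow> int \<times> int \<Rightarrow> (int \<times> int) list \<Rightarrow> (int \<times> int) list \<Rightarrow> rat" where
  "mid u b z v = (if b then wd (u @ [z] @ v) else 0)"

text \<open>\<open>relgen\<close> spreads the bracket over all words u z v. By
  \<open>zmul_Emat\<close> at most two letters z occur in it, so a relation is a combination of at
  most four words.\<close>

lemma relgen_eq:
  assumes x: "x \<in> Letters n" and y: "y \<in> Letters n"
  shows "relgen n (u, x, y, v) = wd (u @ [x, y] @ v) - wd (u @ [y, x] @ v)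
    - (mid u (int n dvd snd x - fst y) (fst x, snd y + snd x - fst y) v
       - mid u (int n dvd snd y - fst x) (fst y, snd x + snd y - fst x) v)"
proof
  fix w
  define C where "C \<longleftrightarrow> length w = length u + 1 + length v \<and> take (length u) w = u
            \<and> drop (length u + 1) w = v \<and> w ! length u \<in> Letters n"
  have "(if C then br n x y (w ! length u) else 0)
      = mid u (int n dvd snd x - fst y) (fst x, snd y + snd x - fst y) v w
       - mid u (int n dvd snd y - fst x) (fst y, snd x + snd y - fst x) v w"
  proof (cases C)
    case True
    define z where "z = w ! length u"
    have z: "z \<in> Letters n" using True by (simp add: C_def z_def)
    have "length u < length w" and td: "take (length u) w = u" "drop (Suc (length u)) w = v"
      using True by (auto simp: C_def)
    from id_take_nth_drop[OF this(1), unfolded td] have w: "w = u @ [z] @ v"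
      unfolding z_def append.simps by assumption
    have "br n x y z = mid u (int n dvd snd x - fst y) (fst x, snd y + snd x - fst y) v w
       - mid u (int n dvd snd y - fst x) (fst y, snd x + snd y - fst x) v w"
      unfolding br_def zmul_Emat[OF x z] zmul_Emat[OF y z] w by (simp add: mid_def wd_def)
    then show ?thesis using True by (simp add: z_def)
  next
    case False
    then have "w \<noteq> u @ [z] @ v" if "z \<in> Letters n" for z using that by (auto simp: C_def nth_append)
    moreover have "(fst x, b) \<in> Letters n" "(fst y, b) \<in> Letters n" for b
      using x y by (auto simp: Letters_def)
    ultimately show ?thesis using False by (auto simp: mid_def wd_def)
  qed
  then show "relgen n (u, x, y, v) w = (wd (u @ [x, y] @ v) - wd (u @ [y, x] @ v)
    - (mid u (int n dvd snd x - fst y) (fst x, snd y + snd x - fst y) v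
       - mid u (int n dvd snd y - fst x) (fst y, snd x + snd y - fst x) v)) w"
    unfolding relgen_def C_def by (simp add: wd_def)
qed

lemma Letters_fst: "x \<in> Letters n \<Longrightarrow> (fst x, b) \<in> Letters n"
  by (auto simp: Letters_def)

lemma mid_in_Tfin:
  "set u \<subseteq> Letters n \<Longrightarrow> set v \<subseteq> Letters n \<Longrightarrow> z \<in> Letters n \<Longrightarrow> mid u b z v \<in> Tfin n"
  using wd_in_Tfin[of "u @ [z] @ v" n] fsp.subspace_0[OF subspace_Tfin] by (simp add: mid_def)

lemma eta_mid: "eta n (mid u b z v) = (if b then eta_word n (u @ [z] @ v) else 0)"
  by (simp only: mid_def eta_wd eta_zero split: if_split) simp

lemma relgen_in_Tfin:
  assumes "q \<in> rel_idx n"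
  shows "relgen n q \<in> Tfin n"
proof -
  obtain u x y v where q: "q = (u, x, y, v)" and L: "set u \<subseteq> Letters n" "x \<in> Letters n" "y \<in> Letters n"
    "set v \<subseteq> Letters n"
    using assms by (auto simp: rel_idx_def)
  show ?thesis
    unfolding q relgen_eq[OF L(2,3)] using L
    by (intro fsp.subspace_diff[OF subspace_Tfin] wd_in_Tfin mid_in_Tfin Letters_fst) auto
qed

lemma diff_diff_zero: "a + d = b + c \<Longrightarrow> a - b - (c - d) = 0" for a b c d :: "'a::ab_group_add"
  by (simp add: algebra_simps)

text \<open>The commutator identity is applied to the image Y of v and then transported through u.
  Both sides are written as sums, so that additivity of the operators of u suffices.\<close>

lemma eta_relgen:
  assumes "q \<in> rel_idx n"
  shows "eta n (relgen n q) = 0"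
proof -
  obtain u x y v where q: "q = (u, x, y, v)" and L: "set u \<subseteq> Letters n" "x \<in> Letters n" "y \<in> Letters n"
    "set v \<subseteq> Letters n"
    using assms by (auto simp: rel_idx_def)
  define Y where "Y = eta_word n v"
  define Z where "Z b z = (if b then opM n z Y else 0)" for b z
  define z1 where "z1 = (fst x, snd y + snd x - fst y)"
  define z2 where "z2 = (fst y, snd x + snd y - fst x)"
  have f0: "foldr (opM n) u 0 = 0"
    using foldr_opM_scale[of n u 0 0] by (simp add: zero_fun_def)
  have word: "eta_word n (u @ [a, b] @ v) = foldr (opM n) u (opM n a (opM n b Y))" for a b
    by (simp add: eta_word_eq Y_def)
  have mid: "eta n (mid u b z v) = foldr (opM n) u (Z b z)" for b z
    unfolding eta_mid using f0 by (cases b) (simp_all add: eta_word_eq Y_def Z_def)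
  have "opM n x (opM n y Y) + Z (int n dvd snd y - fst x) z2
      = opM n y (opM n x Y) + Z (int n dvd snd x - fst y) z1"
  proof (intro ext)
    fix v' w
    show "(opM n x (opM n y Y) + Z (int n dvd snd y - fst x) z2) v' w
      = (opM n y (opM n x Y) + Z (int n dvd snd x - fst y) z1) v' w"
      using opM_commutator[of n x y Y v' w] by (simp add: Z_def z1_def z2_def split: if_splits)
  qed
  then have "foldr (opM n) u (opM n x (opM n y Y)) + foldr (opM n) u (Z (int n dvd snd y - fst x) z2)
      = foldr (opM n) u (opM n y (opM n x Y)) + foldr (opM n) u (Z (int n dvd snd x - fst y) z1)"
    by (simp only: foldr_opM_add[symmetric])
  moreover have "eta n (relgen n q) = eta n (wd (u @ [x, y] @ v)) - eta n (wd (u @ [y, x] @ v))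
      - (eta n (mid u (int n dvd snd x - fst y) z1 v) - eta n (mid u (int n dvd snd y - fst x) z2 v))"
    unfolding q relgen_eq[OF L(2,3)] z1_def z2_def using L
    by (simp only: eta_diff fsp.subspace_diff[OF subspace_Tfin] wd_in_Tfin mid_in_Tfin Letters_fst
        set_append list.set Un_subset_iff insert_subset empty_subsetI simp_thms)
  ultimately show ?thesis
    unfolding eta_wd word mid by (simp only: diff_diff_zero)
qed

section \<open>Kernel and image\<close>

definition words_below :: "nat \<Rightarrow> nat \<Rightarrow> (int \<times> int) list set" where
  "words_below n d = {w. set w \<subseteq> Letters n \<and> length w < d}"

definition Rlow :: "nat \<Rightarrow> nat \<Rightarrow> ((int \<times> int) list \<Rightarrow> rat) set" where
  "Rlow n d = fsp.span (relgen n ` rel_idx n \<union> wd ` words_below n d)"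

lemma subspace_Rlow: "fsp.subspace (Rlow n d)"
  by (simp add: Rlow_def fsp.subspace_span)

lemma wd_in_Rlow: "set w \<subseteq> Letters n \<Longrightarrow> length w < d \<Longrightarrow> wd w \<in> Rlow n d"
  unfolding Rlow_def words_below_def by (intro fsp.span_base) auto

text \<open>The words may have length d itself, because those from the bracket are shorter by one
  letter.\<close>

lemma wd_swap:
  assumes L: "set u \<subseteq> Letters n" "x \<in> Letters n" "y \<in> Letters n" "set v \<subseteq> Letters n"
    and d: "length u + length v + 2 \<le> d"
  shows "wd (u @ [x, y] @ v) - wd (u @ [y, x] @ v) \<in> Rlow n d"
proof -
  have rel: "relgen n (u, x, y, v) \<in> Rlow n d"
    unfolding Rlow_def using L by (intro fsp.span_base UnI1 imageI) (simp add: rel_idx_def)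
  have mid: "mid u b (z, c) v \<in> Rlow n d" if "z \<in> {fst x, fst y}" for b z c
  proof (cases b)
    case True
    have "(z, c) \<in> Letters n" using that L(2,3) Letters_fst by blast
    then show ?thesis using True L d by (simp add: mid_def wd_in_Rlow)
  next
    case False
    then show ?thesis using fsp.subspace_0[OF subspace_Rlow] by (simp only: mid_def if_False)
  qed
  have "wd (u @ [x, y] @ v) - wd (u @ [y, x] @ v) = relgen n (u, x, y, v)
    + (mid u (int n dvd snd x - fst y) (fst x, snd y + snd x - fst y) v
       - mid u (int n dvd snd y - fst x) (fst y, snd x + snd y - fst x) v)"
    unfolding relgen_eq[OF L(2,3)] by (simp only: diff_add_cancel)
  also have "\<dots> \<in> Rlow n d"
    by (intro fsp.subspace_add[OF subspace_Rlow] fsp.subspace_diff[OF subspace_Rlow] rel mid) simp_all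
  finally show ?thesis .
qed

lemma Rlow_trans:
  assumes "f - g \<in> Rlow n d" "g - h \<in> Rlow n d"
  shows "f - h \<in> Rlow n d"
proof -
  have "f - h = (f - g) + (g - h)" by (simp only: diff_add_eq_diff_diff_swap diff_add_cancel add_diff_eq)
  then show ?thesis using fsp.subspace_add[OF subspace_Rlow assms] by (simp only:)
qed

lemma Rlow_refl: "f - f \<in> Rlow n d"
  using fsp.subspace_0[OF subspace_Rlow] by (simp only: diff_self)

lemma wd_move:
  assumes "set p \<subseteq> Letters n" "x \<in> Letters n" "set a \<subseteq> Letters n" "set b \<subseteq> Letters n"
    and "length p + length a + length b + 1 \<le> d"
  shows "wd (p @ x # a @ b) - wd (p @ a @ x # b) \<in> Rlow n d"
  using assms
proof (induction a arbitrary: p)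
  case Nil
  show ?case unfolding append.simps by (rule Rlow_refl)
next
  case (Cons y a)
  have "wd (p @ [x, y] @ (a @ b)) - wd (p @ [y, x] @ (a @ b)) \<in> Rlow n d"
    using Cons.prems by (intro wd_swap) auto
  moreover have "wd ((p @ [y]) @ x # a @ b) - wd ((p @ [y]) @ a @ x # b) \<in> Rlow n d"
    using Cons.prems by (intro Cons.IH) auto
  ultimately show ?case unfolding append.simps append_assoc by (rule Rlow_trans)
qed

text \<open>The head x of \<open>ws\<close> occurs in \<open>ws'\<close> and is moved to the front
  there; the tails are compared with x appended to the common prefix p.\<close>

lemma wd_perm:
  assumes "mset ws = mset ws'" "set p \<subseteq> Letters n" "set ws \<subseteq> Letters n" "length p + length ws \<le> d"
  shows "wd (p @ ws) - wd (p @ ws') \<in> Rlow n d"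
  using assms
proof (induction ws arbitrary: p ws')
  case Nil
  then have "ws' = []" by simp
  then show ?case by (simp only: Rlow_refl)
next
  case (Cons x t)
  have "x \<in> set ws'" using Cons.prems(1) by (metis list.set_intros(1) mset_eq_setD)
  then obtain a b where ws': "ws' = a @ x # b" by (meson split_list)
  have t: "mset t = mset (a @ b)" using Cons.prems(1) by (simp add: ws')
  then have set_t: "set t = set (a @ b)" and len_t: "length t = length (a @ b)"
    by (rule mset_eq_setD, rule mset_eq_length)
  have "wd ((p @ [x]) @ t) - wd ((p @ [x]) @ (a @ b)) \<in> Rlow n d"
    using Cons.prems t by (intro Cons.IH) auto
  moreover have "wd (p @ x # a @ b) - wd (p @ a @ x # b) \<in> Rlow n d"
    using Cons.prems set_t len_t by (intro wd_move) auto
  ultimately show ?case unfolding ws' append.simps append_assoc by (rule Rlow_trans)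
qed

lemma Irel_subset_Tfin: "Irel n \<subseteq> Tfin n"
  unfolding Irel_eq_span
  by (rule fsp.span_minimal[OF _ subspace_Tfin]) (auto simp: relgen_in_Tfin)

lemma eta_Irel:
  assumes "f \<in> Irel n"
  shows "eta n f = 0"
proof -
  have "f \<in> Tfin n \<and> eta n f = 0"
    using assms unfolding Irel_eq_span
  proof (induction rule: fsp.span_induct_alt)
    case base
    show ?case using fsp.subspace_0[OF subspace_Tfin] eta_zero by blast
  next
    case (step c g f)
    then obtain q where q: "q \<in> rel_idx n" "g = relgen n q" by blast
    have f: "f \<in> Tfin n" and g: "(\<lambda>w. c * g w) \<in> Tfin n"
      using step.IH q relgen_in_Tfin fsp.subspace_scale[OF subspace_Tfin] by blast+
    have "eta n ((\<lambda>w. c * g w) + f) = (\<lambda>v u. c * eta n g v u) + eta n f"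
      by (simp only: eta_add[OF g f] eta_scale)
    also have "\<dots> = 0" using eta_relgen[OF q(1)] step.IH unfolding q(2) by (intro ext) simp
    finally show ?case using fsp.subspace_add[OF subspace_Tfin g f] by blast
  qed
  then show ?thesis ..
qed

lemma words_below_subset_Tfin: "fsp.span (wd ` words_below n d) \<subseteq> Tfin n"
  by (rule fsp.span_minimal[OF _ subspace_Tfin]) (auto simp: words_below_def wd_in_Tfin)

lemma eta_words_below:
  assumes n: "n > 0" and "g \<in> fsp.span (wd ` words_below n d)"
  shows "eta n g \<in> Vlow n d"
proof -
  obtain F c where F: "finite F" "F \<subseteq> words_below n d" "g = (\<Sum>p\<in>F. (\<lambda>w. c p * wd p w))"
    using assms(2) unfolding fsp.span_image_explicit by auto
  have T: "(\<lambda>w. c p * wd p w) \<in> Tfin n" if "p \<in> F" for p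
    using that F(2) by (intro fsp.subspace_scale[OF subspace_Tfin] wd_in_Tfin) (auto simp: words_below_def)
  have "eta n g = (\<Sum>p\<in>F. (\<lambda>v u. c p * eta_word n p v u))"
    unfolding F(3) by (simp only: eta_sum T eta_scale eta_wd)
  also have "\<dots> \<in> Vlow n d"
  proof (intro msp.subspace_sum msp.subspace_scale subspace_Vlow)
    fix p assume "p \<in> F"
    then have p: "set p \<subseteq> Letters n" "Suc (length p) \<le> d" using F(2) by (auto simp: words_below_def)
    show "eta_word n p \<in> Vlow n d"
      using eta_word_in_Vlow[OF n p(1)] Vlow_mono[OF p(2)] by blast
  qed
  finally show ?thesis .
qed

text \<open>Removes the words of length d from an element of the kernel, modulo the relations. The
  remainder h consists of shorter words, and it lies in the kernel again because g does.\<close>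

lemma kernel_step:
  assumes n: "n > 0" and f: "f \<in> fsp.span (wd ` words_below n (Suc d))" and zero: "eta n f = 0"
  obtains g h where "g \<in> Irel n" "h \<in> fsp.span (wd ` words_below n d)" "f = g + h"
proof -
  obtain F c where F: "finite F" "F \<subseteq> words_below n (Suc d)" and f_eq: "f = (\<Sum>p\<in>F. (\<lambda>w. c p * wd p w))"
    using f unfolding fsp.span_image_explicit by auto
  define S where "S = {p \<in> F. length p = d}"
  have S: "finite S" using F by (simp add: S_def)
  have SL: "set p \<subseteq> Letters n" "length p = d" if "p \<in> S" for p
    using that F(2) by (auto simp: S_def words_below_def)
  define rep where "rep K = (SOME ws. mset ws = K)" for K :: "(int \<times> int) multiset"
  have rep: "mset (rep K) = K" for K unfolding rep_def by (rule someI_ex) (rule ex_mset)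
  \<comment> \<open>Coefficients of words that are permutations of each other are added up, since
    such words share one representative in t.\<close>
  define a where "a K = (\<Sum>p | p \<in> S \<and> mset p = K. c p)" for K
  define t where "t = (\<Sum>K\<in>mset ` S. (\<lambda>w. a K * wd (rep K) w))"
  have t_eq: "t = (\<Sum>p\<in>S. (\<lambda>w. c p * wd (rep (mset p)) w))"
  proof
    fix w
    have "(\<Sum>p\<in>S. c p * wd (rep (mset p)) w)
        = (\<Sum>K\<in>mset ` S. \<Sum>p | p \<in> S \<and> mset p = K. c p * wd (rep (mset p)) w)"
      by (rule sum.image_gen[OF S])
    also have "\<dots> = (\<Sum>K\<in>mset ` S. a K * wd (rep K) w)"
      by (intro sum.cong refl) (simp add: a_def sum_distrib_right)
    finally show "t w = (\<Sum>p\<in>S. (\<lambda>w. c p * wd (rep (mset p)) w)) w"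
      by (simp add: t_def sum_fun_apply)
  qed
  have "f - t = (\<Sum>p\<in>F - S. (\<lambda>w. c p * wd p w)) + (\<Sum>p\<in>S. (\<lambda>w. c p * (wd p - wd (rep (mset p))) w))"
  proof
    fix w
    have "f w = (\<Sum>p\<in>F - S. c p * wd p w) + (\<Sum>p\<in>S. c p * wd p w)"
      unfolding f_eq sum_fun_apply using F(1) by (intro sum.subset_diff) (auto simp: S_def)
    then show "(f - t) w = ((\<Sum>p\<in>F - S. (\<lambda>w. c p * wd p w)) + (\<Sum>p\<in>S. (\<lambda>w. c p * (wd p - wd (rep (mset p))) w))) w"
      by (simp add: t_eq sum_fun_apply right_diff_distrib sum_subtractf)
  qed
  also have "\<dots> \<in> Rlow n d"
  proof (intro fsp.subspace_add[OF subspace_Rlow] fsp.subspace_sum[OF subspace_Rlow] fsp.subspace_scale[OF subspace_Rlow])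
    fix p assume "p \<in> F - S"
    then show "wd p \<in> Rlow n d"
      using F(2) by (intro wd_in_Rlow) (auto simp: S_def words_below_def)
  next
    fix p assume "p \<in> S"
    then show "wd p - wd (rep (mset p)) \<in> Rlow n d"
      using wd_perm[of p "rep (mset p)" "[]" n d] SL[of p] rep by simp
  qed
  finally obtain g h where g: "g \<in> Irel n" and h: "h \<in> fsp.span (wd ` words_below n d)" and gh: "f - t = g + h"
    unfolding Rlow_def fsp.span_Un Irel_eq_span by auto
  have repL: "set (rep K) \<subseteq> Letters n" "length (rep K) = d" "K \<in> LMsets n" "size K = d" if "K \<in> mset ` S" for K
  proof -
    from that obtain p where p: "p \<in> S" "K = mset p" by blast
    have e: "mset (rep K) = mset p" by (simp add: rep p(2))
    show "set (rep K) \<subseteq> Letters n" "length (rep K) = d" "K \<in> LMsets n" "size K = d"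
      using mset_eq_setD[OF e] mset_eq_length[OF e] SL[OF p(1)] p(2) by auto
  qed
  have T: "(\<lambda>w. a K * wd (rep K) w) \<in> Tfin n" if "K \<in> mset ` S" for K
    using repL[OF that] by (intro fsp.subspace_scale[OF subspace_Tfin] wd_in_Tfin)
  then have tT: "t \<in> Tfin n" unfolding t_def by (intro fsp.subspace_sum[OF subspace_Tfin])
  have gT: "g \<in> Tfin n" using g Irel_subset_Tfin by auto
  have hT: "h \<in> Tfin n" using h words_below_subset_Tfin by auto
  have fgh: "f = g + h + t" using gh by (simp only: diff_eq_eq)
  \<comment> \<open>As f and g are mapped to 0, the image of t is minus that of h, hence of degree
    below d although t consists of words of length d.\<close>
  have "0 = eta n g + eta n h + eta n t"
    using zero unfolding fgh by (simp only: eta_add gT hT tT fsp.subspace_add[OF subspace_Tfin])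
  also have "eta n g = 0" by (rule eta_Irel[OF g])
  finally have "eta n h + eta n t = 0" by (simp only: add_0)
  then have "- eta n h = eta n t" by (rule minus_unique)
  then have et: "eta n t \<in> Vlow n d"
    using msp.subspace_neg[OF subspace_Vlow eta_words_below[OF n h]] by (simp only:)
  have "\<forall>K\<in>mset ` S. \<exists>b. b \<noteq> 0 \<and> eta_word n (rep K) - (\<lambda>v w. b * bm n K v w) \<in> Vlow n d"
  proof
    fix K assume K: "K \<in> mset ` S"
    show "\<exists>b. b \<noteq> 0 \<and> eta_word n (rep K) - (\<lambda>v w. b * bm n K v w) \<in> Vlow n d"
      using eta_word_leading[OF n repL(1)[OF K]] unfolding rep repL(2)[OF K] .
  qed
  from bchoice[OF this] obtain b where b: "\<And>K. K \<in> mset ` S \<Longrightarrow> b K \<noteq> 0"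
    "\<And>K. K \<in> mset ` S \<Longrightarrow> eta_word n (rep K) - (\<lambda>v w. b K * bm n K v w) \<in> Vlow n d"
    by blast
  have et_eq: "eta n t = (\<Sum>K\<in>mset ` S. (\<lambda>v w. a K * eta_word n (rep K) v w))"
    unfolding t_def by (simp only: eta_sum T eta_scale eta_wd)
  \<comment> \<open>The leading part of the image of t is isolated; the rest consists of errors of
    degree below d.\<close>
  have "(\<Sum>K\<in>mset ` S. (\<lambda>v w. (a K * b K) * bm n K v w))
      = eta n t - (\<Sum>K\<in>mset ` S. (\<lambda>v w. a K * (eta_word n (rep K) - (\<lambda>v w. b K * bm n K v w)) v w))"
    unfolding et_eq
    by (intro ext) (simp only: minus_apply sum_fun_apply right_diff_distrib sum_subtractf mult.assoc)
  also have "\<dots> \<in> Vlow n d"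
    by (rule msp.subspace_diff[OF subspace_Vlow et], rule msp.subspace_sum[OF subspace_Vlow],
        rule msp.subspace_scale[OF subspace_Vlow], rule b(2))
  finally have low: "(\<Sum>K\<in>mset ` S. (\<lambda>v w. (a K * b K) * bm n K v w)) \<in> Vlow n d" .
  have "a K = 0" if K: "K \<in> mset ` S" for K
  proof -
    have "mset ` S \<subseteq> {K \<in> LMsets n. size K = d}" using repL(3,4) by blast
    from bm_leading_zero[OF finite_imageI[OF S] this low K] have "a K * b K = 0" .
    then show ?thesis using b(1)[OF K] by simp
  qed
  then have "t = 0" unfolding t_def by (intro ext) (simp add: sum_fun_apply)
  then have "f = g + h" using fgh by (simp only: add_0_right)
  then show thesis using that g h by blast
qed

lemma kernel_words_below:
  assumes n: "n > 0"
  shows "f \<in> fsp.span (wd ` words_below n d) \<Longrightarrow> eta n f = 0 \<Longrightarrow> f \<in> Irel n"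
proof (induction d arbitrary: f)
  case 0
  then have "f = 0" by (simp add: words_below_def)
  then show ?case unfolding Irel_eq_span by (simp only: fsp.span_zero)
next
  case (Suc d)
  obtain g h where gh: "g \<in> Irel n" "h \<in> fsp.span (wd ` words_below n d)" "f = g + h"
    by (rule kernel_step[OF n Suc.prems])
  have gT: "g \<in> Tfin n" and hT: "h \<in> Tfin n"
    using gh(1,2) Irel_subset_Tfin words_below_subset_Tfin by blast+
  have "eta n f = eta n g + eta n h" unfolding gh(3) by (rule eta_add[OF gT hT])
  then have "eta n h = 0" using Suc.prems(2) eta_Irel[OF gh(1)] by (simp only: add_0)
  then have "h \<in> Irel n" by (rule Suc.IH[OF gh(2)])
  then show ?case using gh(1) unfolding gh(3) Irel_eq_span by (intro fsp.span_add)
qed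

lemma Tfin_words_below:
  assumes "f \<in> Tfin n"
  shows "\<exists>d. f \<in> fsp.span (wd ` words_below n d)"
proof -
  define d where "d = Suc (Max (insert 0 (length ` {w. f w \<noteq> 0})))"
  have fin: "finite {w. f w \<noteq> 0}" and L: "\<And>w. f w \<noteq> 0 \<Longrightarrow> set w \<subseteq> Letters n"
    using assms by (auto simp: Tfin_def)
  have "(\<Sum>u | f u \<noteq> 0. (\<lambda>w. f u * wd u w)) \<in> fsp.span (wd ` words_below n d)"
  proof (intro fsp.span_sum fsp.span_scale fsp.span_base imageI)
    fix u assume u: "u \<in> {u. f u \<noteq> 0}"
    then have "length u \<le> Max (insert 0 (length ` {w. f w \<noteq> 0}))" using fin by (intro Max_ge) auto
    then show "u \<in> words_below n d" using u L by (simp add: words_below_def d_def)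
  qed
  then show ?thesis using Tfin_expand[OF assms] by (intro exI[of _ d]) (simp only:)
qed

lemma kernel_eta:
  assumes n: "n > 0"
  shows "{f \<in> Tfin n. eta n f = 0} = Irel n"
proof (intro equalityI subsetI)
  fix f assume f: "f \<in> {f \<in> Tfin n. eta n f = 0}"
  then obtain d where "f \<in> fsp.span (wd ` words_below n d)" using Tfin_words_below by blast
  then show "f \<in> Irel n" using kernel_words_below[OF n] f by blast
next
  fix f assume "f \<in> Irel n"
  then show "f \<in> {f \<in> Tfin n. eta n f = 0}" using Irel_subset_Tfin eta_Irel by blast
qed

section \<open>The image of eta and closure under products\<close>

lemma subspace_range_eta: "msp.subspace (eta n ` Tfin n)"
proof (rule msp.subspaceI)
  show "0 \<in> eta n ` Tfin n"
    using eta_zero[of n] fsp.subspace_0[OF subspace_Tfin, of n] by (metis image_eqI)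
next
  fix X Y assume "X \<in> eta n ` Tfin n" "Y \<in> eta n ` Tfin n"
  then obtain f g where "f \<in> Tfin n" "g \<in> Tfin n" "X = eta n f" "Y = eta n g" by blast
  then show "X + Y \<in> eta n ` Tfin n"
    using eta_add fsp.subspace_add[OF subspace_Tfin] by (intro image_eqI[of _ _ "f + g"]) (simp_all only:)
next
  fix c X assume "X \<in> eta n ` Tfin n"
  then obtain f where "f \<in> Tfin n" "X = eta n f" by blast
  then show "(\<lambda>v w. c * X v w) \<in> eta n ` Tfin n"
    using eta_scale fsp.subspace_scale[OF subspace_Tfin] by (intro image_eqI[of _ _ "\<lambda>w. c * f w"]) (simp_all only:)
qed

text \<open>Triangularity: a basis element of degree d is the image of a word minus an error of
  lower degree, divided by the nonzero leading coefficient.\<close>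

lemma Vlow_subset_range_eta:
  assumes n: "n > 0"
  shows "Vlow n d \<subseteq> eta n ` Tfin n"
proof (induction d)
  case 0
  show ?case
    using msp.subspace_0[OF subspace_range_eta] by (simp add: Vlow_def)
next
  case (Suc d)
  have "bm n K \<in> eta n ` Tfin n" if K: "K \<in> LMsets n" "size K < Suc d" for K
  proof -
    obtain ws where ws: "mset ws = K" using ex_mset by blast
    then have L: "set ws \<subseteq> Letters n" using K(1) mset_in_LMsets by blast
    obtain c where c: "c \<noteq> 0" "eta_word n ws - (\<lambda>v w. c * bm n K v w) \<in> Vlow n (length ws)"
      using eta_word_leading[OF n L] unfolding ws by blast
    define r where "r = eta_word n ws - (\<lambda>v w. c * bm n K v w)"
    have "length ws \<le> d" using K(2) ws by auto
    then have r: "r \<in> eta n ` Tfin n"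
      using c(2) Vlow_mono[of "length ws" d n] Suc.IH unfolding r_def by blast
    have "eta_word n ws \<in> eta n ` Tfin n"
      using eta_wd[of n ws] wd_in_Tfin[OF L] by (metis image_eqI)
    from msp.subspace_scale[OF subspace_range_eta msp.subspace_diff[OF subspace_range_eta this r], of "1 / c"]
    have "(\<lambda>v w. 1 / c * (eta_word n ws - r) v w) \<in> eta n ` Tfin n" .
    moreover have "(\<lambda>v w. 1 / c * (eta_word n ws - r) v w) = bm n K"
      using c(1) by (intro ext) (simp add: r_def)
    ultimately show ?thesis by (simp only:)
  qed
  then show ?case unfolding Vlow_def by (intro msp.span_minimal subspace_range_eta) auto
qed

lemma range_eta:
  assumes n: "n > 0"
  shows "eta n ` Tfin n = Aspan n"
proof (intro equalityI subsetI)
  fix X assume "X \<in> eta n ` Tfin n"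
  then obtain f where f: "f \<in> Tfin n" "X = eta n f" by blast
  obtain d where "f \<in> fsp.span (wd ` words_below n d)" using Tfin_words_below[OF f(1)] by blast
  then show "X \<in> Aspan n" using eta_words_below[OF n] Vlow_subset_Aspan[OF n] unfolding f(2) by blast
next
  fix X assume "X \<in> Aspan n"
  then show "X \<in> eta n ` Tfin n" using Aspan_in_Vlow[OF n] Vlow_subset_range_eta[OF n] by blast
qed

lemma colfin_Aspan:
  assumes n: "n > 0" and "Y \<in> Aspan n"
  shows "colfin Y"
proof -
  obtain F c where F: "finite F" "Y = (\<Sum>K\<in>F. (\<lambda>v w. c K * bm n K v w))"
    using assms(2) unfolding Aspan_eq_span[OF n] msp.span_image_explicit by auto
  have "{v. Y v w \<noteq> 0} \<subseteq> (\<Union>K\<in>F. {v. bm n K v w \<noteq> 0})" for w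
  proof (rule subsetI, rule ccontr)
    fix v assume "v \<in> {v. Y v w \<noteq> 0}" and v: "v \<notin> (\<Union>K\<in>F. {v. bm n K v w \<noteq> 0})"
    moreover have "Y v w = 0" unfolding F(2) sum_fun_apply using v by (intro sum.neutral) auto
    ultimately show False by simp
  qed
  then show ?thesis
    unfolding colfin_def using F(1) finite_bm_column by (meson finite_UN_I finite_subset)
qed

lemma foldr_opM_Aspan:
  assumes n: "n > 0" and Y: "Y \<in> Aspan n" and "set ws \<subseteq> Letters n"
  shows "foldr (opM n) ws Y \<in> Aspan n"
  using assms(3)
proof (induction ws)
  case Nil
  then show ?case using Y by simp
next
  case (Cons x ws)
  then obtain d where "foldr (opM n) ws Y \<in> Vlow n d" using Aspan_in_Vlow[OF n] by auto
  then have "opM n x (foldr (opM n) ws Y) \<in> Vlow n (Suc d)" using Cons.prems by (intro opM_Vlow[OF n]) auto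
  then show ?case using Vlow_subset_Aspan[OF n] by auto
qed

text \<open>Writing X as the image of some f turns left multiplication by X into a combination of
  iterated letter operators, each of which preserves the span.\<close>

lemma mprod_Aspan:
  assumes n: "n > 0" and X: "X \<in> Aspan n" and Y: "Y \<in> Aspan n"
  shows "mprod X Y \<in> Aspan n"
proof -
  obtain f where f: "f \<in> Tfin n" "X = eta n f" using X unfolding range_eta[OF n, symmetric] by blast
  have "mprod X Y = (\<Sum>ws | f ws \<noteq> 0. (\<lambda>v w. f ws * mprod (eta_word n ws) Y v w))"
  proof (intro ext)
    fix v w
    have "mprod X Y v w = (\<Sum>u | Y u w \<noteq> 0. \<Sum>ws | f ws \<noteq> 0. f ws * (eta_word n ws v u * Y u w))"
      by (simp add: mprod_def f(2) eta_def sum_distrib_right mult.assoc)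
    also have "\<dots> = (\<Sum>ws | f ws \<noteq> 0. f ws * mprod (eta_word n ws) Y v w)"
      unfolding mprod_def sum_distrib_left by (rule sum.swap)
    finally show "mprod X Y v w = (\<Sum>ws | f ws \<noteq> 0. (\<lambda>v w. f ws * mprod (eta_word n ws) Y v w)) v w"
      by (simp add: sum_fun_apply)
  qed
  also have "\<dots> \<in> Aspan n"
    unfolding Aspan_eq_span[OF n]
  proof (intro msp.span_sum msp.span_scale)
    fix ws assume "ws \<in> {ws. f ws \<noteq> 0}"
    then have "set ws \<subseteq> Letters n" using f(1) by (auto simp: Tfin_def)
    then show "mprod (eta_word n ws) Y \<in> msp.span (bm n ` LMsets n)"
      using foldr_opM_Aspan[OF n Y] unfolding mprod_eta_word[OF colfin_Aspan[OF n Y]] Aspan_eq_span[OF n]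
      by blast
  qed
  finally show ?thesis .
qed

lemma Aj_independent:
  assumes n: "n > 0" and F: "finite F" "F \<subseteq> AIdx n"
    and zero: "(\<lambda>v w. \<Sum>p\<in>F. c p * Aj n (fst p) (snd p) v w) = (\<lambda>v w. 0)" and p: "p \<in> F"
  shows "c p = 0"
proof -
  note bij = AIdx_mset_bij[OF n]
  have inj: "inj_on (AIdx_mset n) F" using bij F(2) by (auto simp: bij_betw_def intro: inj_on_subset)
  define g where "g = the_inv_into F (AIdx_mset n)"
  have g: "g (AIdx_mset n q) = q" if "q \<in> F" for q
    using that inj by (simp add: g_def the_inv_into_f_f)
  have "(\<Sum>K\<in>AIdx_mset n ` F. c (g K) * bm n K v w) = 0" for v w
  proof -
    have "(\<Sum>K\<in>AIdx_mset n ` F. c (g K) * bm n K v w) = (\<Sum>q\<in>F. c q * Aj n (fst q) (snd q) v w)"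
    proof (subst sum.reindex[OF inj], rule sum.cong[OF refl])
      fix q assume q: "q \<in> F"
      then have "Aj n (fst q) (snd q) = bm n (AIdx_mset n q)"
        using F(2) Aj_eq_bm[OF n, of "fst q" "snd q"] by (auto simp: AIdx_def)
      then show "((\<lambda>K. c (g K) * bm n K v w) \<circ> AIdx_mset n) q = c q * Aj n (fst q) (snd q) v w"
        using g[OF q] by simp
    qed
    then show ?thesis using fun_cong[OF fun_cong[OF zero, of v], of w] by simp
  qed
  moreover have "AIdx_mset n ` F \<subseteq> LMsets n" using bij F(2) unfolding bij_betw_def by blast
  ultimately have "c (g (AIdx_mset n p)) = 0"
    using F(1) p by (intro bm_independent[of "AIdx_mset n ` F" n "\<lambda>K. c (g K)"]) auto
  then show ?thesis using g[OF p] by simp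
qed

theorem theorem6p3p4:
  fixes n :: nat
  assumes "n \<ge> 2"
  shows "(\<forall>A j. A \<in> ThetaPM n \<longrightarrow> j \<in> NDelta n \<longrightarrow> Aj n A j \<in> SchurProd n)
       \<and> idm \<in> Aspan n
       \<and> (\<forall>X \<in> Aspan n. \<forall>Y \<in> Aspan n. mprod X Y \<in> Aspan n)
       \<and> (\<forall>F c. finite F \<longrightarrow> F \<subseteq> AIdx n \<longrightarrow>
            (\<lambda>v w. \<Sum>p\<in>F. c p * Aj n (fst p) (snd p) v w) = (\<lambda>v w. 0) \<longrightarrow>
            (\<forall>p\<in>F. c p = 0))
       \<and> {f \<in> Tfin n. eta n f = (\<lambda>v w. 0)} = Irel n
       \<and> eta n ` Tfin n = Aspan n"
proof (intro conjI allI impI ballI)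
  have n: "n > 0" using assms by simp
  show "Aj n A j \<in> SchurProd n" if "A \<in> ThetaPM n" "j \<in> NDelta n" for A j
    using that by (rule Aj_in_SchurProd[OF n])
  show "idm \<in> Aspan n"
    unfolding Aspan_eq_span[OF n] idm_eq_bm[of n] by (intro msp.span_base imageI) (simp add: LMsets_def)
  show "mprod X Y \<in> Aspan n" if "X \<in> Aspan n" "Y \<in> Aspan n" for X Y
    using that by (rule mprod_Aspan[OF n])
  show "c p = 0"
    if "finite F" "F \<subseteq> AIdx n" "(\<lambda>v w. \<Sum>p\<in>F. c p * Aj n (fst p) (snd p) v w) = (\<lambda>v w. 0)" "p \<in> F"
    for F c p
    using that by (rule Aj_independent[OF n])
  have "(\<lambda>v w. 0) = (0 :: mat)" by (intro ext) simp
  then show "{f \<in> Tfin n. eta n f = (\<lambda>v w. 0)} = Irel n" using kernel_eta[OF n] by (simp only:)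
  show "eta n ` Tfin n = Aspan n" by (rule range_eta[OF n])
qed

end
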